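(* Let $X$ be a (real or complex) Banach space and let $T : X \to X$ be a generalized hyperbolic operator. Then $T$ is strongly structurally stable; that is, for every $\gamma > 0$ there exists $\varepsilon > 0$ such that for every bounded uniformly continuous Lipschitz map $\varphi : X \to X$ with $\|\varphi\|_\infty \leq \varepsilon$ and $\operatorname{Lip}(\varphi) \leq \varepsilon$, there is a homeomorphism $h : X \to X$ such that $h \circ T = (T + \varphi) \circ h$ and $\|h - I\|_\infty \leq \gamma$.
   Context: For a map $\varphi : X \to X$ on a Banach space $X$, $\|\varphi\|_\infty = \sup_{x \in X} \|\varphi(x)\|$ and $\operatorname{Lip}(\varphi) = \sup_{x \neq y} \frac{\|\varphi(x)-\varphi(y)\|}{\|x-y\|}$. $I$ denotes the identity operator on $X$, $\mathbb{D}$ the open unit disc in the complex plane, and $\sigma(\cdot)$ the spectrum of a bounded linear operator (in the case of real Banach spaces, the spectrum of its complexification). An invertible bounded linear operator $T$ on $X$ is said to be generalized hyperbolic if one can write $X = M \oplus N$, where $M$ and $N$ are closed subspaces of $X$ such that $T(M) \subset M$, $T^{-1}(N) \subset N$, $\sigma(T|_M) \subset \mathbb{D}$ and $\sigma(T^{-1}|_N) \subset \mathbb{D}$. Here $T|_M$ and $T^{-1}|_N$ are regarded as bounded linear operators on $M$ and on $N$, respectively. (The inclusions $T(M)\subset M$ and $T^{-1}(N)\subset N$ may be strict.) *)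

theory Defs
  imports "HOL-Analysis.Analysis"
begin

class complex_banach = banach +
  fixes scaleC :: "complex \<Rightarrow> 'a \<Rightarrow> 'a"  (infixr "*\<^sub>C" 75)
  assumes scaleC_add_right: "c *\<^sub>C (x + y) = c *\<^sub>C x + c *\<^sub>C y"
    and scaleC_add_left: "(c + d) *\<^sub>C x = c *\<^sub>C x + d *\<^sub>C x"
    and scaleC_scaleC: "c *\<^sub>C d *\<^sub>C x = (c * d) *\<^sub>C x"
    and scaleC_of_real: "complex_of_real r *\<^sub>C x = r *\<^sub>R x"
    and norm_scaleC: "norm (c *\<^sub>C x) = cmod c * norm x"

lemma vector_space_scaleC: "vector_space (scaleC :: complex \<Rightarrow> 'a::complex_banach \<Rightarrow> 'a)"
proof
  show "1 *\<^sub>C x = x" for x :: 'a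
    using scaleC_of_real [of 1 x] by simp
qed (simp_all add: scaleC_add_right scaleC_add_left scaleC_scaleC)

instantiation complex :: complex_banach
begin
definition "c *\<^sub>C (z::complex) = c * z"
instance
  by intro_classes
    (simp_all add: scaleC_complex_def algebra_simps norm_mult scaleR_conv_of_real)
end

text \<open>
  A bounded operator on a subspace \<open>V\<close> is represented by a total function of which only the
  values on \<open>V\<close> matter. The complex scalar multiplication is a parameter, because the spectrum
  below is needed both on complex Banach spaces and on complexifications.
\<close>

definition bounded_operator_on ::
    "(complex \<Rightarrow> 'v \<Rightarrow> 'v) \<Rightarrow> 'v::real_normed_vector set \<Rightarrow> ('v \<Rightarrow> 'v) \<Rightarrow> bool" where
  "bounded_operator_on sc V S \<longleftrightarrow>
     (\<forall>x\<in>V. S x \<in> V) \<and>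
     (\<forall>x\<in>V. \<forall>y\<in>V. S (x + y) = S x + S y) \<and>
     (\<forall>c. \<forall>x\<in>V. S (sc c x) = sc c (S x)) \<and>
     (\<exists>K. \<forall>x\<in>V. norm (S x) \<le> K * norm x)"

definition spectrum_on ::
    "(complex \<Rightarrow> 'v \<Rightarrow> 'v) \<Rightarrow> 'v::real_normed_vector set \<Rightarrow> ('v \<Rightarrow> 'v) \<Rightarrow> complex set" where
  "spectrum_on sc V S =
     {\<mu>. \<not> (\<exists>R. bounded_operator_on sc V R \<and>
               (\<forall>x\<in>V. R (S x - sc \<mu> x) = x \<and> S (R x) - sc \<mu> (R x) = x))}"

abbreviation complex_spectrum_on ::
    "'a::complex_banach set \<Rightarrow> ('a \<Rightarrow> 'a) \<Rightarrow> complex set" where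
  "complex_spectrum_on \<equiv> spectrum_on scaleC"

text \<open>
  The complexification of a real space \<open>M\<close> is \<open>M \<times> M\<close>, with \<open>(x, y)\<close> standing for \<open>x + i y\<close>.
  The product norm is not homogeneous for complex scalars in general, but it is equivalent to the
  usual norms on the complexification (for instance
  \<open>sup\<^sub>t \<parallel>cos t x + sin t y\<parallel>\<close>), and the spectrum depends on the norm only up to equivalence.
\<close>

definition complexification_scale :: "complex \<Rightarrow> 'a::real_vector \<times> 'a \<Rightarrow> 'a \<times> 'a" where
  "complexification_scale c = (\<lambda>(x, y). (Re c *\<^sub>R x - Im c *\<^sub>R y, Re c *\<^sub>R y + Im c *\<^sub>R x))"

lemma vector_space_complexification_scale:
  "vector_space (complexification_scale :: complex \<Rightarrow> 'a::real_vector \<times> 'a \<Rightarrow> 'a \<times> 'a)"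
  by unfold_locales (auto simp: complexification_scale_def algebra_simps)

definition real_spectrum_on ::
    "'a::real_normed_vector set \<Rightarrow> ('a \<Rightarrow> 'a) \<Rightarrow> complex set" where
  "real_spectrum_on M S = spectrum_on complexification_scale (M \<times> M) (map_prod S S)"

definition generalized_hyperbolic_real :: "('a::banach \<Rightarrow> 'a) \<Rightarrow> bool" where
  "generalized_hyperbolic_real T \<longleftrightarrow>
     bounded_linear T \<and> bij T \<and> bounded_linear (inv T) \<and>
     (\<exists>M N. subspace M \<and> closed M \<and> subspace N \<and> closed N \<and>
        {m + n | m n. m \<in> M \<and> n \<in> N} = UNIV \<and> M \<inter> N = {0} \<and>
        T ` M \<subseteq> M \<and> inv T ` N \<subseteq> N \<and>
        real_spectrum_on M T \<subseteq> ball 0 1 \<and>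
        real_spectrum_on N (inv T) \<subseteq> ball 0 1)"

definition generalized_hyperbolic_complex :: "('a::complex_banach \<Rightarrow> 'a) \<Rightarrow> bool" where
  "generalized_hyperbolic_complex T \<longleftrightarrow>
     Vector_Spaces.linear scaleC scaleC T \<and>
     bounded_linear T \<and> bij T \<and> bounded_linear (inv T) \<and>
     (\<exists>M N. module.subspace scaleC M \<and> closed M \<and> module.subspace scaleC N \<and> closed N \<and>
        {m + n | m n. m \<in> M \<and> n \<in> N} = UNIV \<and> M \<inter> N = {0} \<and>
        T ` M \<subseteq> M \<and> inv T ` N \<subseteq> N \<and>
        complex_spectrum_on M T \<subseteq> ball 0 1 \<and>
        complex_spectrum_on N (inv T) \<subseteq> ball 0 1)"

text \<open>The suprema are taken in \<open>[0, \<infinity>]\<close>: unbounded maps have value \<open>\<infinity>\<close>, and the supremum over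
  the empty set, which occurs on the zero space, is \<open>0\<close>.\<close>

definition sup_norm :: "('a \<Rightarrow> 'b::real_normed_vector) \<Rightarrow> ennreal" where
  "sup_norm f = (SUP x. ennreal (norm (f x)))"

definition Lip :: "('a::real_normed_vector \<Rightarrow> 'b::real_normed_vector) \<Rightarrow> ennreal" where
  "Lip f = (SUP (x, y)\<in>{(x, y). x \<noteq> y}. ennreal (norm (f x - f y) / norm (x - y)))"

definition strongly_structurally_stable :: "('a::real_normed_vector \<Rightarrow> 'a) \<Rightarrow> bool" where
  "strongly_structurally_stable T \<longleftrightarrow>
     (\<forall>\<gamma>>0. \<exists>\<epsilon>>0. \<forall>\<phi>.
        bounded (range \<phi>) \<and> uniformly_continuous_on UNIV \<phi> \<and>
        (\<exists>L. L-lipschitz_on UNIV \<phi>) \<and>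
        sup_norm \<phi> \<le> ennreal \<epsilon> \<and> Lip \<phi> \<le> ennreal \<epsilon> \<longrightarrow>
        (\<exists>h. (\<exists>g. homeomorphism UNIV UNIV h g) \<and>
             h \<circ> T = (\<lambda>x. T x + \<phi> x) \<circ> h \<and>
             sup_norm (\<lambda>x. h x - x) \<le> ennreal \<gamma>))"

end

theory Submission
  imports Defs
begin

text \<open>
  Let \<open>P\<close> be the projection of \<open>X = M \<oplus> N\<close> onto \<open>M\<close> along \<open>N\<close> and \<open>Q = I - P\<close>. The spectral assumptions
  make \<open>T\<^sup>k P\<close> and \<open>T\<^bsup>-k\<^esup> Q\<close> decay geometrically, so for a bijection \<open>R\<close> of \<open>X\<close> and a bounded map
  \<open>v\<close> the series
    \<open>(G\<^sub>R v) x = (\<Sum>k. T\<^sup>k (P (v (R\<^bsup>-(k+1)\<^esup> x)))) - (\<Sum>k. T\<^bsup>-(k+1)\<^esup> (Q (v (R\<^sup>k x))))\<close>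
  converges uniformly, and \<open>w = G\<^sub>R v\<close> is a bounded solution of \<open>w \<circ> R = T \<circ> w + v\<close>. The
  identity \<open>P + Q = I\<close> supplies the term \<open>v\<close>, at the index where the two series meet.

  Put \<open>R = T + \<phi>\<close>, which is a homeomorphism when \<open>\<phi>\<close> has a small Lipschitz constant. A map \<open>h = I + u\<close>
  satisfies \<open>h \<circ> T = R \<circ> h\<close> as soon as \<open>u = G\<^sub>T (\<phi> \<circ> h)\<close>, and this is a contraction equation for \<open>u\<close>
  among the bounded continuous maps. Conversely \<open>g = I - G\<^sub>R \<phi>\<close> satisfies \<open>g \<circ> R = T \<circ> g\<close>.

  When \<open>T(M)\<close> is strictly smaller than \<open>M\<close> the bounded solutions of these equations need not be unique, so
  \<open>g\<close> and \<open>h\<close> cannot be recognised as mutually inverse by the uniqueness argument that works for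
  hyperbolic operators. What replaces it is the naturality of the series: if \<open>h \<circ> R\<^sub>1 = R\<^sub>2 \<circ> h\<close>, then
  \<open>G\<close> for \<open>R\<^sub>1\<close> of \<open>v \<circ> h\<close> equals \<open>(G v) \<circ> h\<close> for \<open>R\<^sub>2\<close>, because \<open>h\<close> carries orbits to orbits
  (\<open>green_semiconjugacy\<close>). Applied to \<open>h\<close> it gives \<open>u = (G\<^sub>R \<phi>) \<circ> h\<close>, that is \<open>g \<circ> h = I\<close>. Applied to \<open>g\<close>
  it gives \<open>h \<circ> g - I = G\<^sub>R (\<phi> \<circ> h \<circ> g) - G\<^sub>R \<phi>\<close>, whose supremum is at most half of the supremum of
  \<open>h \<circ> g - I\<close> itself, so \<open>h \<circ> g = I\<close> (\<open>conjugacy\<close>).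

  Two facts of functional analysis feed this argument. A bounded operator whose spectrum lies in
  the open unit disc has a power of norm at most \<open>1/2\<close> (\<open>power_contracts_of_spectrum\<close>). This is the part
  of the spectral radius formula that matters here, and it is shown without vector-valued
  holomorphic functions, by averaging the resolvent over roots of unity. The projection \<open>P\<close> is
  bounded (\<open>bounded_projection_exists\<close>), by the proof of the open mapping theorem applied to
  addition \<open>M \<times> N \<rightarrow> X\<close>.
\<close>

section \<open>Power decay from the spectrum\<close>

lemma norm_average_le:
  fixes f :: "nat \<Rightarrow> 'v::real_normed_vector"
  assumes "n \<ge> 1" "\<And>k. norm (f k) \<le> b"
  shows "norm ((1 / real n) *\<^sub>R (\<Sum>k<n. f k)) \<le> b"
proof -
  have "norm (\<Sum>k<n. f k) \<le> real n * b"
    using sum_norm_le[of "{..<n}" f "\<lambda>_. b"] assms by simp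
  then show ?thesis using assms by (simp add: field_simps)
qed

text \<open>
  Complexifications with the product norm and complex Banach spaces are treated together: the norm
  is homogeneous for complex scalars only up to the factor \<open>B\<close>, while real scalars, which form the
  averages below, act isometrically.
\<close>

locale complex_scaling =
  fixes sc :: "complex \<Rightarrow> 'v \<Rightarrow> 'v::real_normed_vector" and V :: "'v set" and B :: real
  assumes vector_space_sc: "vector_space sc"
    and sc_of_real: "sc (complex_of_real r) x = r *\<^sub>R x"
    and norm_sc: "norm (sc c x) \<le> B * cmod c * norm x"
    and subspace_V: "module.subspace sc V"
begin

lemma module_sc: "module sc"
  using vector_space_sc by (simp add: module_iff_vector_space)

lemma V_closed: "0 \<in> V" "x \<in> V \<Longrightarrow> y \<in> V \<Longrightarrow> x + y \<in> V" "x \<in> V \<Longrightarrow> y \<in> V \<Longrightarrow> x - y \<in> V"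
  "x \<in> V \<Longrightarrow> sc c x \<in> V"
  using module.subspace_0[OF module_sc subspace_V] module.subspace_add[OF module_sc subspace_V]
    module.subspace_diff[OF module_sc subspace_V] module.subspace_scale[OF module_sc subspace_V]
  by auto

lemma sc_simps: "sc c (sc d x) = sc (c * d) x" "sc 1 x = x" "sc 0 x = 0" "sc c 0 = 0"
  "sc (- c) x = - sc c x" "sc c (- x) = - sc c x" "sc (c - d) x = sc c x - sc d x" "sc c (x - y) = sc c x - sc c y"
  "sc (sum a I) x = (\<Sum>i\<in>I. sc (a i) x)"
  using module.scale_scale[OF module_sc] module.scale_one[OF module_sc]
    module.scale_zero_left[OF module_sc] module.scale_zero_right[OF module_sc]
    module.scale_minus_left[OF module_sc] module.scale_minus_right[OF module_sc]
    module.scale_left_diff_distrib[OF module_sc]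
    module.scale_right_diff_distrib[OF module_sc] module.scale_sum_left[OF module_sc]
  by auto

lemma operator_mem: "bounded_operator_on sc V S \<Longrightarrow> x \<in> V \<Longrightarrow> S x \<in> V"
  by (auto simp: bounded_operator_on_def)

lemma operator_scale: "bounded_operator_on sc V S \<Longrightarrow> x \<in> V \<Longrightarrow> S (sc c x) = sc c (S x)"
  by (auto simp: bounded_operator_on_def)

lemma operator_add:
  "bounded_operator_on sc V S \<Longrightarrow> x \<in> V \<Longrightarrow> y \<in> V \<Longrightarrow> S (x + y) = S x + S y"
  by (auto simp: bounded_operator_on_def)

lemma operator_diff:
  assumes "bounded_operator_on sc V S" "x \<in> V" "y \<in> V"
  shows "S (x - y) = S x - S y"
  using operator_add[OF assms(1), of "x - y" y] assms V_closed by simp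

lemma operator_zero: "bounded_operator_on sc V S \<Longrightarrow> S 0 = 0"
  using operator_diff[of S 0 0] V_closed by auto

lemma operator_bound:
  assumes "bounded_operator_on sc V S"
  obtains K where "K > 0" "\<And>x. x \<in> V \<Longrightarrow> norm (S x) \<le> K * norm x"
proof -
  obtain K where K: "\<And>x. x \<in> V \<Longrightarrow> norm (S x) \<le> K * norm x"
    using assms unfolding bounded_operator_on_def by blast
  show ?thesis
  proof (rule that[of "\<bar>K\<bar> + 1"])
    fix x assume "x \<in> V"
    have "norm (S x) \<le> K * norm x" using K \<open>x \<in> V\<close> by blast
    also have "\<dots> \<le> (\<bar>K\<bar> + 1) * norm x" by (rule mult_right_mono) auto
    finally show "norm (S x) \<le> (\<bar>K\<bar> + 1) * norm x" .
  qed simp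
qed

lemma funpow_mem: "bounded_operator_on sc V S \<Longrightarrow> x \<in> V \<Longrightarrow> (S ^^ n) x \<in> V"
  by (induction n) (auto intro: operator_mem)

text \<open>
  For \<open>z \<noteq> 0\<close> the inverse of \<open>I - z S = - z (S - z\<^bsup>-1\<^esup>)\<close> comes from the resolvent at \<open>z\<^bsup>-1\<^esup>\<close>. In the
  parameter \<open>z\<close> the complement of the open disc becomes the closed unit disc, which is compact and
  contains the trivial point \<open>z = 0\<close>.
\<close>

lemma resolvent_exists:
  assumes S: "bounded_operator_on sc V S" and spec: "spectrum_on sc V S \<subseteq> ball 0 1"
    and z: "cmod z \<le> 1"
  shows "\<exists>R. bounded_operator_on sc V R \<and>
           (\<forall>x\<in>V. R (x - sc z (S x)) = x \<and> R x - sc z (S (R x)) = x)"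
proof (cases "z = 0")
  case True
  have "bounded_operator_on sc V (\<lambda>x. x)"
    by (auto simp: bounded_operator_on_def intro: exI[of _ 1])
  then show ?thesis using True by (auto simp: sc_simps)
next
  case False
  define \<mu> where "\<mu> = inverse z"
  have "cmod \<mu> \<ge> 1" using z False by (simp add: \<mu>_def norm_inverse one_le_inverse_iff)
  then have "\<mu> \<notin> spectrum_on sc V S" using spec by fastforce
  then obtain R where R: "bounded_operator_on sc V R"
    and inv: "\<And>x. x \<in> V \<Longrightarrow> R (S x - sc \<mu> x) = x" "\<And>x. x \<in> V \<Longrightarrow> S (R x) - sc \<mu> (R x) = x"
    unfolding spectrum_on_def by auto
  obtain K where K: "K > 0" "\<And>x. x \<in> V \<Longrightarrow> norm (R x) \<le> K * norm x"
    using operator_bound[OF R] by blast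
  define R' where "R' = (\<lambda>x. R (sc (- \<mu>) x))"
  have z\<mu>: "z * \<mu> = 1" using False by (simp add: \<mu>_def)
  have "norm (R' x) \<le> (K * (B * cmod \<mu>)) * norm x" if "x \<in> V" for x
  proof -
    have "norm (R' x) \<le> K * norm (sc (- \<mu>) x)"
      unfolding R'_def by (intro K(2) V_closed that)
    also have "\<dots> \<le> K * (B * cmod (- \<mu>) * norm x)"
      using norm_sc[of "- \<mu>" x] K(1) by (intro mult_left_mono) auto
    finally show ?thesis by simp
  qed
  moreover have "R' (sc c x) = sc c (R' x)" if "x \<in> V" for c x
    using operator_scale[OF R V_closed(4)[OF that], of c "- \<mu>"] by (simp add: R'_def sc_simps(1) mult.commute)
  moreover have "R' (x + y) = R' x + R' y" if "x \<in> V" "y \<in> V" for x y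
    using operator_add[OF R V_closed(4)[OF that(1)] V_closed(4)[OF that(2)], of "- \<mu>" "- \<mu>"]
    by (simp add: R'_def module.scale_right_distrib[OF module_sc])
  ultimately have "bounded_operator_on sc V R'"
    using operator_mem[OF R V_closed(4)] unfolding bounded_operator_on_def
    by (auto simp: R'_def)
  moreover have "R' (x - sc z (S x)) = x" if "x \<in> V" for x
  proof -
    have "sc (- \<mu>) (x - sc z (S x)) = S x - sc \<mu> x"
      using z\<mu> by (simp add: sc_simps mult.commute)
    then show ?thesis using inv(1)[OF that] by (simp add: R'_def)
  qed
  moreover have "R' x - sc z (S (R' x)) = x" if "x \<in> V" for x
  proof -
    define y where "y = R x"
    have y: "y \<in> V" using operator_mem[OF R that] by (simp add: y_def)
    have R'x: "R' x = sc (- \<mu>) y"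
      using operator_scale[OF R that] by (simp add: R'_def y_def)
    have "R' x - sc z (S (R' x)) = S y - sc \<mu> y"
      unfolding R'x operator_scale[OF S y] using z\<mu> by (simp add: sc_simps)
    then show ?thesis using inv(2)[OF that] by (simp add: y_def)
  qed
  ultimately show ?thesis by blast
qed

end

locale resolvent_on_disc = complex_scaling sc V B
  for sc :: "complex \<Rightarrow> 'v \<Rightarrow> 'v::real_normed_vector" and V B +
  fixes S :: "'v \<Rightarrow> 'v" and R :: "complex \<Rightarrow> 'v \<Rightarrow> 'v"
  assumes S: "bounded_operator_on sc V S"
    and R: "cmod z \<le> 1 \<Longrightarrow> bounded_operator_on sc V (R z)"
    and R_left: "cmod z \<le> 1 \<Longrightarrow> x \<in> V \<Longrightarrow> R z (x - sc z (S x)) = x"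
    and R_right: "cmod z \<le> 1 \<Longrightarrow> x \<in> V \<Longrightarrow> R z x - sc z (S (R z x)) = x"
begin

lemma resolvent_identity:
  assumes z: "cmod z \<le> 1" and w: "cmod w \<le> 1" and x: "x \<in> V"
  shows "R z x - R w x = R z (sc (z - w) (S (R w x)))"
proof -
  let ?y = "R w x"
  have y: "?y \<in> V" "S ?y \<in> V" using operator_mem R[OF w] S x by blast+
  have "R z x - ?y = R z (?y - sc w (S ?y)) - R z (?y - sc z (S ?y))"
    using R_left[OF z y(1)] R_right[OF w x] by simp
  also have "\<dots> = R z ((?y - sc w (S ?y)) - (?y - sc z (S ?y)))"
    using y by (intro operator_diff[OF R[OF z], symmetric] V_closed)
  also have "(?y - sc w (S ?y)) - (?y - sc z (S ?y)) = sc (z - w) (S ?y)"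
    by (simp add: sc_simps)
  finally show ?thesis .
qed

lemma norm_resolvent_diff:
  assumes z: "cmod z \<le> 1" and w: "cmod w \<le> 1" and x: "x \<in> V"
    and Kz: "Kz > 0" "\<And>x. x \<in> V \<Longrightarrow> norm (R z x) \<le> Kz * norm x"
    and KS: "KS > 0" "\<And>x. x \<in> V \<Longrightarrow> norm (S x) \<le> KS * norm x"
  shows "norm (R z x - R w x) \<le> Kz * (\<bar>B\<bar> * cmod (z - w) * (KS * norm (R w x)))"
proof -
  let ?y = "R w x"
  have y: "?y \<in> V" "S ?y \<in> V" using operator_mem R[OF w] S x by blast+
  have "norm (R z x - R w x) \<le> Kz * norm (sc (z - w) (S ?y))"
    unfolding resolvent_identity[OF z w x] by (intro Kz(2) V_closed y)
  also have "norm (sc (z - w) (S ?y)) \<le> \<bar>B\<bar> * cmod (z - w) * norm (S ?y)"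
    using norm_sc[of "z - w" "S ?y"]
    by (rule order_trans) (intro mult_right_mono; simp)
  also have "\<dots> \<le> \<bar>B\<bar> * cmod (z - w) * (KS * norm ?y)"
    using KS(2)[OF y(1)] by (intro mult_left_mono) auto
  finally show ?thesis using Kz(1) by simp
qed

text \<open>
  By the resolvent identity a bound \<open>k\<close> at \<open>z\<close> gives the bound \<open>2 k\<close> on a neighbourhood of \<open>z\<close>;
  compactness of the disc makes the bound uniform.
\<close>

lemma resolvent_uniformly_bounded:
  obtains K where "K > 0" "\<And>z x. cmod z \<le> 1 \<Longrightarrow> x \<in> V \<Longrightarrow> norm (R z x) \<le> K * norm x"
proof -
  obtain KS where KS: "KS > 0" "\<And>x. x \<in> V \<Longrightarrow> norm (S x) \<le> KS * norm x"
    using operator_bound[OF S] by blast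
  have "\<exists>k>0. \<forall>x\<in>V. norm (R z x) \<le> k * norm x" if z: "cmod z \<le> 1" for z
  proof -
    obtain k where "k > 0" "\<And>x. x \<in> V \<Longrightarrow> norm (R z x) \<le> k * norm x"
      using operator_bound[OF R[OF z]] by blast
    then show ?thesis by blast
  qed
  then have "\<forall>z. \<exists>k. cmod z \<le> 1 \<longrightarrow> k > 0 \<and> (\<forall>x\<in>V. norm (R z x) \<le> k * norm x)"
    by blast
  from choice[OF this] obtain k where "\<forall>z. cmod z \<le> 1 \<longrightarrow> k z > 0 \<and> (\<forall>x\<in>V. norm (R z x) \<le> k z * norm x)"
    by blast
  then have k: "\<And>z. cmod z \<le> 1 \<Longrightarrow> k z > 0"
    "\<And>z x. cmod z \<le> 1 \<Longrightarrow> x \<in> V \<Longrightarrow> norm (R z x) \<le> k z * norm x"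
    by blast+
  \<comment> \<open>The radius within which the perturbation term of the resolvent identity absorbs at most
    half of the norm.\<close>
  define d where "d z = 1 / (2 * k z * (\<bar>B\<bar> + 1) * KS)" for z
  have d: "d z > 0" if "cmod z \<le> 1" for z using k(1)[OF that] KS(1) by (simp add: d_def)
  have near: "norm (R w x) \<le> 2 * k z * norm x"
    if z: "cmod z \<le> 1" and w: "cmod w \<le> 1" and zw: "cmod (z - w) < d z" and x: "x \<in> V" for z w x
  proof -
    have kz: "k z > 0" using k(1)[OF z] .
    have "norm (R z x - R w x) \<le> k z * (\<bar>B\<bar> * cmod (z - w) * (KS * norm (R w x)))"
      using norm_resolvent_diff[OF z w x k(1)[OF z] k(2)[OF z] KS] .
    also have "\<dots> \<le> k z * ((\<bar>B\<bar> + 1) * d z * (KS * norm (R w x)))"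
      using kz KS(1) zw by (intro mult_left_mono mult_right_mono mult_mono) auto
    also have "\<dots> = norm (R w x) / 2"
    proof -
      have pos: "\<bar>B\<bar> + 1 > 0" by linarith
      have cancel: "k z * (b * (1 / (2 * k z * b * KS)) * (KS * r)) = r / 2" if "b > 0" for b r
        using that kz KS(1) by (simp add: field_simps)
      show ?thesis unfolding d_def by (rule cancel[OF pos])
    qed
    finally have "norm (R z x - R w x) \<le> norm (R w x) / 2" .
    moreover have "norm (R w x) \<le> norm (R z x) + norm (R z x - R w x)"
      by (metis norm_minus_commute norm_triangle_sub)
    moreover have "norm (R z x) \<le> k z * norm x" using k(2)[OF z x] .
    ultimately show ?thesis by linarith
  qed
  have "cball 0 1 \<subseteq> (\<Union>z\<in>cball 0 1. ball z (d z))"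
    using d by (auto intro!: bexI)
  then obtain C where C: "C \<subseteq> cball (0::complex) 1" "finite C"
    and cover: "cball 0 1 \<subseteq> (\<Union>z\<in>C. ball z (d z))"
    by (rule compactE_image[OF compact_cball open_ball])
  define K where "K = 1 + (\<Sum>z\<in>C. 2 * k z)"
  have nonneg: "0 \<le> 2 * k z" if "z \<in> C" for z
    using k(1)[of z] C(1) that by force
  show ?thesis
  proof (rule that[of K])
    show "K > 0" unfolding K_def using sum_nonneg[of C "\<lambda>z. 2 * k z"] nonneg by force
    fix w x assume w: "cmod w \<le> 1" and x: "x \<in> V"
    obtain z where z: "z \<in> C" "w \<in> ball z (d z)" using cover w by force
    have "cmod z \<le> 1" using z C by auto
    then have "norm (R w x) \<le> 2 * k z * norm x"
      using near[of z w x] w x z by (auto simp: dist_norm)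
    also have "\<dots> \<le> K * norm x"
      using member_le_sum[OF z(1), of "\<lambda>z. 2 * k z"] nonneg C(2)
      by (intro mult_right_mono) (auto simp: K_def)
    finally show "norm (R w x) \<le> K * norm x" .
  qed
qed

lemma resolvent_Lipschitz:
  obtains L where "L > 0"
    "\<And>z w x. cmod z \<le> 1 \<Longrightarrow> cmod w \<le> 1 \<Longrightarrow> x \<in> V \<Longrightarrow>
       norm (R z x - R w x) \<le> L * cmod (z - w) * norm x"
proof -
  obtain KS where KS: "KS > 0" "\<And>x. x \<in> V \<Longrightarrow> norm (S x) \<le> KS * norm x"
    using operator_bound[OF S] by blast
  obtain K where K: "K > 0" "\<And>z x. cmod z \<le> 1 \<Longrightarrow> x \<in> V \<Longrightarrow> norm (R z x) \<le> K * norm x"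
    using resolvent_uniformly_bounded by blast
  show ?thesis
  proof (rule that[of "K * (\<bar>B\<bar> + 1) * KS * K"])
    fix z w x assume z: "cmod z \<le> 1" and w: "cmod w \<le> 1" and x: "x \<in> V"
    have "norm (R z x - R w x) \<le> K * (\<bar>B\<bar> * cmod (z - w) * (KS * norm (R w x)))"
      using norm_resolvent_diff[OF z w x K(1) K(2)[OF z] KS] .
    also have "\<dots> \<le> K * ((\<bar>B\<bar> + 1) * cmod (z - w) * (KS * (K * norm x)))"
      using K KS(1) w x by (intro mult_left_mono mult_right_mono mult_mono) auto
    finally show "norm (R z x - R w x) \<le> K * (\<bar>B\<bar> + 1) * KS * K * cmod (z - w) * norm x"
      by (simp add: mult_ac)
  qed (use K KS in \<open>auto intro!: mult_pos_pos\<close>)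
qed

text \<open>
  The telescoping identity \<open>I - z\<^sup>n S\<^sup>n = (I - z S) (\<Sum>j<n. z\<^sup>j S\<^sup>j)\<close> with the first factor
  cancelled.
\<close>

lemma resolvent_of_power:
  assumes z: "cmod z \<le> 1" and x: "x \<in> V"
  shows "R z (x - sc (z ^ n) ((S ^^ n) x)) = (\<Sum>j<n. sc (z ^ j) ((S ^^ j) x))"
proof (induction n)
  case 0
  show ?case using operator_zero[OF R[OF z]] by (simp add: sc_simps)
next
  case (Suc n)
  define y where "y = sc (z ^ n) ((S ^^ n) x)"
  have m: "(S ^^ n) x \<in> V" using funpow_mem[OF S x] .
  have y: "y \<in> V" "S y \<in> V" using m by (auto simp: y_def intro!: operator_mem[OF S] V_closed)
  have "sc (z ^ Suc n) ((S ^^ Suc n) x) = sc z (S y)"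
    using operator_scale[OF S m] by (simp add: y_def sc_simps)
  then have "R z (x - sc (z ^ Suc n) ((S ^^ Suc n) x)) = R z ((x - y) + (y - sc z (S y)))"
    by simp
  also have "\<dots> = R z (x - y) + R z (y - sc z (S y))"
    using x y by (intro operator_add[OF R[OF z]] V_closed)
  also have "\<dots> = (\<Sum>j<Suc n. sc (z ^ j) ((S ^^ j) x))"
    using Suc R_left[OF z y(1)] by (simp add: y_def)
  finally show ?case .
qed

text \<open>
  The mean of the resolvent over the \<open>n\<close> points \<open>t \<omega>\<close> with \<open>\<omega>\<^sup>n = 1\<close>. It inverts \<open>I - t\<^sup>n S\<^sup>n\<close>, yet
  its bound and its modulus of continuity in \<open>t\<close> are those of the resolvent and do not depend on \<open>n\<close>.
\<close>

definition avg :: "nat \<Rightarrow> real \<Rightarrow> 'v \<Rightarrow> 'v" where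
  "avg n t x = (1 / real n) *\<^sub>R (\<Sum>k<n. R (of_real t * cis (2 * pi * real k / real n)) x)"

text \<open>
  Averaging \<open>\<Sum>j<n. (t \<omega>)\<^sup>j S\<^sup>j\<close> over the \<open>n\<close>-th roots of unity \<open>\<omega>\<close> leaves only the term \<open>j = 0\<close>.
\<close>

lemma avg_left_inverse:
  assumes n: "n \<ge> 1" and t: "0 \<le> t" "t \<le> 1" and x: "x \<in> V"
  shows "avg n t (x - t ^ n *\<^sub>R (S ^^ n) x) = x"
proof -
  define \<omega> where "\<omega> k = cis (2 * pi * real k / real n)" for k
  have \<omega>n: "\<omega> k ^ n = 1" for k
  proof -
    have "\<omega> k ^ n = cis (2 * pi * real k)" using Complex.DeMoivre[of "2 * pi * real k / real n" n] n by (simp add: \<omega>_def)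
    then show ?thesis by (simp add: cis_multiple_2pi)
  qed
  have \<omega>sum: "(\<Sum>k<n. \<omega> k ^ j) = (if j = 0 then of_nat n else 0)" if "j < n" for j
  proof (cases "j = 0")
    case False
    let ?q = "cis (2 * pi * real j / real n)"
    have "?q \<noteq> 1"
    proof
      assume "?q = 1"
      have "exp (\<i> * of_real (2 * pi * real j / real n)) = 1"
        using \<open>?q = 1\<close> by (simp add: cis_conv_exp)
      then have "exp (2 * of_real pi * \<i> * of_nat j / of_nat n) = (1::complex)"
        by (simp add: mult_ac)
      then have "n dvd j" using complex_root_unity_eq_1[of n j] n by simp
      then show False using False that by (auto dest: dvd_imp_le)
    qed
    moreover have "?q ^ n = 1" using \<omega>n[of j] by (simp add: \<omega>_def)
    moreover have "\<omega> k ^ j = ?q ^ k" for k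
      by (simp add: \<omega>_def Complex.DeMoivre mult_ac)
    ultimately show ?thesis using False by (simp add: geometric_sum)
  qed simp
  have R\<omega>: "R (of_real t * \<omega> k) (x - t ^ n *\<^sub>R (S ^^ n) x) =
      (\<Sum>j<n. sc (\<omega> k ^ j) (t ^ j *\<^sub>R (S ^^ j) x))" for k
  proof -
    have c: "cmod (of_real t * \<omega> k) \<le> 1" using t by (simp add: \<omega>_def norm_mult)
    have e: "(of_real t * \<omega> k) ^ n = of_real (t ^ n)" by (simp add: power_mult_distrib \<omega>n)
    show ?thesis
      using resolvent_of_power[OF c x, of n]
      unfolding e sc_of_real
      by (simp add: power_mult_distrib sc_simps mult.commute flip: sc_of_real)
  qed
  have "(\<Sum>k<n. R (of_real t * \<omega> k) (x - t ^ n *\<^sub>R (S ^^ n) x)) =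
      (\<Sum>k<n. \<Sum>j<n. sc (\<omega> k ^ j) (t ^ j *\<^sub>R (S ^^ j) x))"
    by (simp add: R\<omega>)
  also have "\<dots> = (\<Sum>j<n. sc (\<Sum>k<n. \<omega> k ^ j) (t ^ j *\<^sub>R (S ^^ j) x))"
    by (subst sum.swap) (simp add: sc_simps)
  also have "\<dots> = (\<Sum>j<n. if j = 0 then real n *\<^sub>R x else 0)"
    using sc_of_real[of "real n"] by (intro sum.cong refl) (simp add: \<omega>sum sc_simps)
  also have "\<dots> = real n *\<^sub>R x" using n by (simp add: sum.delta)
  finally show ?thesis using n by (simp add: avg_def \<omega>_def)
qed

text \<open>
  The step size, limited by \<open>1 / (6 L)\<close>, is the same at every \<open>s\<close>, so finitely many steps lead from
  \<open>s = 0\<close> to \<open>s = 1\<close>. If some power of \<open>s S\<close> contracts, then a high power \<open>m\<close> of \<open>s S\<close> is so small that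
  the average for \<open>s\<close> lies within \<open>1/6\<close> of the identity; the average for \<open>t\<close> then lies within \<open>1/3\<close>
  of it, which forces \<open>t\<^sup>m S\<^sup>m\<close> to be small.
\<close>

lemma power_contracts_step:
  assumes K: "K > 0" "\<And>z x. cmod z \<le> 1 \<Longrightarrow> x \<in> V \<Longrightarrow> norm (R z x) \<le> K * norm x"
    and L: "L > 0" "\<And>z w x. cmod z \<le> 1 \<Longrightarrow> cmod w \<le> 1 \<Longrightarrow> x \<in> V \<Longrightarrow>
       norm (R z x - R w x) \<le> L * cmod (z - w) * norm x"
    and s: "0 \<le> s" "s \<le> t" "t \<le> 1" "L * (t - s) \<le> 1 / 6"
    and n: "n \<ge> 1" "\<And>x. x \<in> V \<Longrightarrow> s ^ n * norm ((S ^^ n) x) \<le> 1 / 2 * norm x"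
  shows "\<exists>m\<ge>1. \<forall>x\<in>V. t ^ m * norm ((S ^^ m) x) \<le> 1 / 2 * norm x"
proof -
  have pow: "s ^ (n * j) * norm ((S ^^ (n * j)) x) \<le> (1 / 2) ^ j * norm x" if "x \<in> V" for j x
  proof (induction j)
    case (Suc j)
    define y where "y = (S ^^ (n * j)) x"
    have y: "y \<in> V" using funpow_mem[OF S that] by (simp add: y_def)
    have "s ^ (n * Suc j) * norm ((S ^^ (n * Suc j)) x) = s ^ (n * j) * (s ^ n * norm ((S ^^ n) y))"
      by (simp add: y_def power_add funpow_add)
    also have "\<dots> \<le> s ^ (n * j) * (1 / 2 * norm y)"
      using n(2)[OF y] s by (intro mult_left_mono) auto
    also have "\<dots> \<le> 1 / 2 * ((1 / 2) ^ j * norm x)" using Suc by (simp add: y_def)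
    finally show ?case by simp
  qed simp
  obtain j where j: "(1 / 2) ^ j < 1 / (6 * K)"
    using real_arch_pow_inv[of "1 / (6 * K)" "1 / 2"] K by auto
  define m where "m = n * Suc j"
  have m: "m \<ge> 1" using n by (simp add: m_def)
  have "t ^ m * norm ((S ^^ m) x) \<le> 1 / 2 * norm x" if x: "x \<in> V" for x
  proof -
    have close: "norm (avg m t y - y) \<le> 1 / 3 * norm y" if y: "y \<in> V" for y
    proof -
      have Sy: "s ^ m *\<^sub>R (S ^^ m) y \<in> V"
        using V_closed(4)[OF funpow_mem[OF S y], of "of_real (s ^ m)" m] by (simp only: sc_of_real)
      have small: "norm (s ^ m *\<^sub>R (S ^^ m) y) \<le> 1 / (6 * K) * norm y"
      proof -
        have "norm (s ^ m *\<^sub>R (S ^^ m) y) = s ^ m * norm ((S ^^ m) y)" using s by simp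
        also have "\<dots> \<le> (1 / 2) ^ Suc j * norm y" unfolding m_def by (rule pow[OF y])
        also have "\<dots> \<le> 1 / (6 * K) * norm y"
        proof -
          have "(1 / 2 :: real) ^ Suc j \<le> (1 / 2) ^ j" by simp
          then show ?thesis using j by (intro mult_right_mono) (linarith, simp)
        qed
        finally show ?thesis .
      qed
      have disc: "cmod (of_real r * cis a) \<le> 1" if "0 \<le> r" "r \<le> 1" for r a
        using that by (simp add: norm_mult)
      have dist: "cmod (of_real t * cis a - of_real s * cis a) = t - s" for a
        using s by (simp add: norm_mult flip: left_diff_distrib of_real_diff)
      have "avg m s y - y = avg m s y - avg m s (y - s ^ m *\<^sub>R (S ^^ m) y)"
        using avg_left_inverse[OF m _ _ y, of s] s by simp
      also have "\<dots> = (1 / real m) *\<^sub>R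
          (\<Sum>k<m. R (of_real s * cis (2 * pi * real k / real m)) (s ^ m *\<^sub>R (S ^^ m) y))"
        unfolding avg_def scaleR_diff_right[symmetric] sum_subtractf[symmetric]
        using y Sy disc[of s] s
        by (intro arg_cong[of _ _ "scaleR (1 / real m)"] sum.cong refl)
           (simp add: operator_diff[OF R])
      also have "norm \<dots> \<le> 1 / 6 * norm y"
      proof (rule norm_average_le[OF m])
        fix k
        let ?z = "of_real s * cis (2 * pi * real k / real m)"
        have "norm (R ?z (s ^ m *\<^sub>R (S ^^ m) y)) \<le> K * norm (s ^ m *\<^sub>R (S ^^ m) y)"
          using K(2)[OF disc Sy] s by simp
        also have "\<dots> \<le> K * (1 / (6 * K) * norm y)"
          using small K(1) by (intro mult_left_mono) auto
        finally show "norm (R ?z (s ^ m *\<^sub>R (S ^^ m) y)) \<le> 1 / 6 * norm y"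
          using K(1) by simp
      qed
      finally have 1: "norm (avg m s y - y) \<le> 1 / 6 * norm y" .
      have "avg m t y - avg m s y = (1 / real m) *\<^sub>R
          (\<Sum>k<m. R (of_real t * cis (2 * pi * real k / real m)) y
                - R (of_real s * cis (2 * pi * real k / real m)) y)"
        by (simp add: avg_def sum_subtractf scaleR_diff_right)
      also have "norm \<dots> \<le> 1 / 6 * norm y"
      proof (rule norm_average_le[OF m])
        fix k
        let ?c = "cis (2 * pi * real k / real m)"
        have "norm (R (of_real t * ?c) y - R (of_real s * ?c) y) \<le> L * (t - s) * norm y"
          using L(2)[of "of_real t * ?c" "of_real s * ?c", OF disc disc y] s unfolding dist by simp
        also have "\<dots> \<le> 1 / 6 * norm y" using s by (intro mult_right_mono) auto
        finally show "norm (R (of_real t * ?c) y - R (of_real s * ?c) y) \<le> 1 / 6 * norm y" .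
      qed
      finally have 2: "norm (avg m t y - avg m s y) \<le> 1 / 6 * norm y" .
      have "avg m t y - y = (avg m t y - avg m s y) + (avg m s y - y)" by simp
      then show ?thesis
        using 1 2 norm_triangle_ineq[of "avg m t y - avg m s y" "avg m s y - y"] by simp
    qed
    define w where "w = t ^ m *\<^sub>R (S ^^ m) x"
    have w: "w \<in> V"
      unfolding w_def using V_closed(4)[OF funpow_mem[OF S x], of "of_real (t ^ m)" m] by (simp only: sc_of_real)
    \<comment> \<open>The average for \<open>t\<close> maps \<open>x - w\<close> to \<open>x\<close>, so it moves \<open>x - w\<close> by exactly \<open>w\<close>.\<close>
    have "norm w \<le> 1 / 3 * norm (x - w)"
      using close[OF V_closed(3)[OF x w]] avg_left_inverse[OF m _ _ x, of t] s
      by (simp add: w_def)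
    moreover have "norm (x - w) \<le> norm x + norm w" by (rule norm_triangle_ineq4)
    moreover have "norm w = t ^ m * norm ((S ^^ m) x)" using s by (simp add: w_def)
    ultimately show ?thesis by linarith
  qed
  then show ?thesis using m by blast
qed

lemma power_contracts: "\<exists>n\<ge>1. \<forall>x\<in>V. norm ((S ^^ n) x) \<le> 1 / 2 * norm x"
proof -
  obtain K where K: "K > 0" "\<And>z x. cmod z \<le> 1 \<Longrightarrow> x \<in> V \<Longrightarrow> norm (R z x) \<le> K * norm x"
    using resolvent_uniformly_bounded by blast
  obtain L where L: "L > 0"
    "\<And>z w x. cmod z \<le> 1 \<Longrightarrow> cmod w \<le> 1 \<Longrightarrow> x \<in> V \<Longrightarrow>
       norm (R z x - R w x) \<le> L * cmod (z - w) * norm x"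
    using resolvent_Lipschitz by blast
  define \<delta> where "\<delta> = 1 / (6 * L)"
  have \<delta>: "\<delta> > 0" "L * \<delta> = 1 / 6" using L(1) by (auto simp: \<delta>_def)
  have steps: "\<exists>n\<ge>1. \<forall>x\<in>V. (min 1 (real j * \<delta>)) ^ n * norm ((S ^^ n) x) \<le> 1 / 2 * norm x" for j
  proof (induction j)
    case 0
    then show ?case by (intro exI[of _ 1]) simp
  next
    case (Suc j)
    let ?s = "min 1 (real j * \<delta>)" and ?t = "min 1 (real (Suc j) * \<delta>)"
    have "?s \<ge> 0" "?s \<le> ?t" "?t \<le> 1" "?t - ?s \<le> \<delta>"
      using \<delta>(1) by (auto simp: min_def algebra_simps)
    moreover have "L * (?t - ?s) \<le> 1 / 6"
      using \<open>?t - ?s \<le> \<delta>\<close> L(1) \<delta>(2) by (metis mult_left_mono less_imp_le)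
    ultimately show ?case using Suc power_contracts_step[OF K L, of ?s ?t] by blast
  qed
  obtain j where "1 < real j * \<delta>" using reals_Archimedean3[OF \<delta>(1)] by blast
  then have "min 1 (real j * \<delta>) = 1" by simp
  then show ?thesis using steps[of j] by simp
qed

end

text \<open>
  A substitute for the spectral radius formula: one contracting power already yields geometric
  decay of all powers.
\<close>

theorem (in complex_scaling) power_contracts_of_spectrum:
  assumes S: "bounded_operator_on sc V S" and spec: "spectrum_on sc V S \<subseteq> ball 0 1"
  obtains n where "n \<ge> 1" "\<And>x. x \<in> V \<Longrightarrow> norm ((S ^^ n) x) \<le> 1 / 2 * norm x"
proof -
  obtain R where "\<And>z. cmod z \<le> 1 \<Longrightarrow> bounded_operator_on sc V (R z) \<and>
           (\<forall>x\<in>V. R z (x - sc z (S x)) = x \<and> R z x - sc z (S (R z x)) = x)"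
    using resolvent_exists[OF S spec] by metis
  then interpret resolvent_on_disc sc V B S R
    by unfold_locales (use S in auto)
  show ?thesis using power_contracts that by blast
qed

section \<open>Bounded projections along closed complements\<close>

lemma Baire_real_normed:
  fixes F :: "nat \<Rightarrow> 'a::banach set"
  assumes closed: "\<And>n. closed (F n)" and cover: "(\<Union>n. F n) = UNIV"
  obtains n x r where "r > 0" "ball x r \<subseteq> F n"
proof -
  have "\<exists>n. interior (F n) \<noteq> {}"
  proof (rule ccontr)
    assume "\<nexists>n. interior (F n) \<noteq> {}"
    then have "euclidean interior_of \<Union>(range F) = {}"
      using closed
      by (intro Baire_category_alt)
         (auto simp: completely_metrizable_space_euclidean interior_of_def interior_def)
    then show False using cover by simp
  qed
  then obtain n x where "x \<in> interior (F n)" by auto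
  then show thesis using that unfolding mem_interior by blast
qed

text \<open>
  The Baire category half of the open mapping theorem for addition \<open>M \<times> N \<rightarrow> X\<close>: up to an error that
  is halved, vectors decompose with control of the norms of the parts.
\<close>

lemma approximate_bounded_decomposition:
  fixes M N :: "'a::banach set"
  assumes M: "subspace M" and N: "subspace N"
    and sum: "{m + n | m n. m \<in> M \<and> n \<in> N} = UNIV"
  obtains C where "C > 0"
    "\<And>x. \<exists>m\<in>M. \<exists>n\<in>N. norm m \<le> C * norm x \<and> norm n \<le> C * norm x \<and> norm (x - (m + n)) \<le> norm x / 2"
proof -
  \<comment> \<open>The sums of vectors of norm at most \<open>k\<close>. Some \<open>D k\<close> is dense in a ball; being convex and
    symmetric it is then dense in a ball around the origin.\<close>
  define D where "D k = (\<Union>m\<in>M \<inter> cball 0 (real k). \<Union>n\<in>N \<inter> cball 0 (real k). {m + n})" for k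
  have "\<exists>k. x \<in> closure (D k)" for x
  proof -
    obtain m n where mn: "m \<in> M" "n \<in> N" "x = m + n" using sum by blast
    obtain k where "max (norm m) (norm n) \<le> real k" using real_arch_simple by blast
    then have "m \<in> M \<inter> cball 0 (real k)" "n \<in> N \<inter> cball 0 (real k)" using mn by auto
    then have "x \<in> D k" unfolding D_def mn(3) by blast
    then show ?thesis using closure_subset by blast
  qed
  then have "(\<Union>k. closure (D k)) = UNIV" by blast
  then obtain k a r where r: "r > 0" and ball: "ball a r \<subseteq> closure (D k)"
    using Baire_real_normed[of "\<lambda>k. closure (D k)"] closed_closure by metis
  have "convex (D k)"
    unfolding D_def by (intro convex_sums convex_Int convex_cball subspace_imp_convex M N)
  then have conv: "convex (closure (D k))" by (rule convex_closure)
  have symD: "(\<lambda>y. - y) ` D k \<subseteq> D k"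
  proof -
    have "- y \<in> D k" if y: "y \<in> D k" for y
    proof -
      obtain m n where mn: "m \<in> M \<inter> cball 0 (real k)" "n \<in> N \<inter> cball 0 (real k)" "y = m + n"
        using y unfolding D_def by blast
      have "- y = - m + - n" "- m \<in> M \<inter> cball 0 (real k)" "- n \<in> N \<inter> cball 0 (real k)"
        using mn M N by (auto simp: subspace_neg)
      then show ?thesis unfolding D_def by blast
    qed
    then show ?thesis by blast
  qed
  have sym: "- y \<in> closure (D k)" if "y \<in> closure (D k)" for y
  proof -
    have "(\<lambda>y. - y) ` closure (D k) \<subseteq> closure (D k)"
      by (rule image_closure_subset) (use symD closure_subset in \<open>auto intro!: continuous_intros\<close>)
    then show ?thesis using that by blast
  qed
  have small: "y \<in> closure (D k)" if "norm y < r" for y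
  proof -
    have "a + y \<in> closure (D k)" "a - y \<in> closure (D k)"
      using ball that by (auto simp: dist_norm subset_iff)
    then have "(1/2) *\<^sub>R (a + y) + (1/2) *\<^sub>R (- (a - y)) \<in> closure (D k)"
      by (intro convexD[OF conv] sym) auto
    moreover have "(1/2) *\<^sub>R (a + y) + (1/2) *\<^sub>R (- (a - y)) = y"
      by (simp add: algebra_simps flip: scaleR_left.add)
    ultimately show ?thesis by simp
  qed
  \<comment> \<open>Vectors are scaled to norm \<open>r / 2\<close>; the summand \<open>1\<close> keeps \<open>C\<close> positive when \<open>k = 0\<close>.\<close>
  define C where "C = 2 * real k / r + 1"
  show thesis
  proof (rule that[of C])
    show "C > 0" using r by (simp add: C_def add_nonneg_pos)
    fix x :: 'a
    show "\<exists>m\<in>M. \<exists>n\<in>N. norm m \<le> C * norm x \<and> norm n \<le> C * norm x \<and> norm (x - (m + n)) \<le> norm x / 2"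
    proof (cases "x = 0")
      case True
      then show ?thesis using M N by (auto intro!: bexI[of _ 0] simp: subspace_0)
    next
      case False
      define t where "t = r / (2 * norm x)"
      have t: "t > 0" using False r by (simp add: t_def)
      have "norm (t *\<^sub>R x) < r" using False r by (simp add: t_def)
      then have "t *\<^sub>R x \<in> closure (D k)" by (rule small)
      moreover have "t * norm x / 2 > 0" using t False by simp
      ultimately obtain y where "y \<in> D k" "dist y (t *\<^sub>R x) < t * norm x / 2"
        unfolding closure_approachable by blast
      then obtain m n where mn: "m \<in> M" "n \<in> N" "norm m \<le> real k" "norm n \<le> real k"
        and d: "norm (t *\<^sub>R x - (m + n)) \<le> t * norm x / 2"
        by (auto simp: D_def dist_norm norm_minus_commute)
      have bound: "norm ((1 / t) *\<^sub>R v) \<le> C * norm x" if "norm v \<le> real k" for v :: 'a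
      proof -
        have "norm ((1 / t) *\<^sub>R v) \<le> real k / t" using that t by (simp add: divide_right_mono)
        also have "\<dots> = 2 * real k / r * norm x" using r False by (simp add: t_def)
        also have "\<dots> \<le> C * norm x" by (intro mult_right_mono) (auto simp: C_def)
        finally show ?thesis .
      qed
      have "x - ((1 / t) *\<^sub>R m + (1 / t) *\<^sub>R n) = (1 / t) *\<^sub>R (t *\<^sub>R x - (m + n))"
        using t by (simp add: algebra_simps)
      then have "norm (x - ((1 / t) *\<^sub>R m + (1 / t) *\<^sub>R n)) = norm (t *\<^sub>R x - (m + n)) / t"
        using t by simp
      also have "\<dots> \<le> norm x / 2" using d t by (simp add: field_simps)
      finally have "norm (x - ((1 / t) *\<^sub>R m + (1 / t) *\<^sub>R n)) \<le> norm x / 2" .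
      then show ?thesis
        using bound mn M N by (meson subspace_scale)
    qed
  qed
qed

text \<open>
  Iterating the approximate decomposition on the remainders gives two geometrically convergent
  series, whose sums stay in \<open>M\<close> and \<open>N\<close> because these are closed. Uniqueness of the decomposition
  makes the choice linear.
\<close>

theorem bounded_projection_exists:
  fixes M N :: "'a::banach set"
  assumes M: "subspace M" "closed M" and N: "subspace N" "closed N"
    and sum: "{m + n | m n. m \<in> M \<and> n \<in> N} = UNIV" and int: "M \<inter> N = {0}"
  obtains P where "bounded_linear P" "\<And>x. P x \<in> M" "\<And>x. x - P x \<in> N"
proof -
  obtain C where C: "C > 0"
    and ex: "\<And>x. \<exists>m\<in>M. \<exists>n\<in>N. norm m \<le> C * norm x \<and> norm n \<le> C * norm x \<and> norm (x - (m + n)) \<le> norm x / 2"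
    using approximate_bounded_decomposition[OF M(1) N(1) sum] by blast
  then obtain \<mu> \<nu> where \<mu>: "\<And>x. \<mu> x \<in> M" "\<And>x. norm (\<mu> x) \<le> C * norm x"
    and \<nu>: "\<And>x. \<nu> x \<in> N" "\<And>x. norm (\<nu> x) \<le> C * norm x"
    and half: "\<And>x. norm (x - (\<mu> x + \<nu> x)) \<le> norm x / 2"
    by metis
  have bounded: "\<exists>m\<in>M. x - m \<in> N \<and> norm m \<le> 2 * C * norm x" for x
  proof -
    \<comment> \<open>The successive remainders, which shrink by the factor \<open>1/2\<close>.\<close>
    define y where "y k = ((\<lambda>z. z - (\<mu> z + \<nu> z)) ^^ k) x" for k
    have y0: "y 0 = x" and ySuc: "y (Suc k) = y k - (\<mu> (y k) + \<nu> (y k))" for k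
      by (auto simp: y_def)
    have ybound: "norm (y k) \<le> (1 / 2) ^ k * norm x" for k
    proof (induction k)
      case (Suc k)
      then show ?case using half[of "y k"] by (simp add: ySuc)
    qed (simp add: y0)
    have geo: "(\<lambda>k. C * norm x * (1 / 2) ^ k) sums (C * norm x * 2)"
      using sums_mult[OF geometric_sums[of "1/2::real"]] by simp
    have b: "norm (\<mu> (y k)) \<le> C * norm x * (1 / 2) ^ k" "norm (\<nu> (y k)) \<le> C * norm x * (1 / 2) ^ k" for k
    proof -
      have "C * norm (y k) \<le> C * ((1 / 2) ^ k * norm x)"
        using ybound[of k] C by (intro mult_left_mono) auto
      then have "C * norm (y k) \<le> C * norm x * (1 / 2) ^ k" by (simp only: mult_ac)
      then show "norm (\<mu> (y k)) \<le> C * norm x * (1 / 2) ^ k" "norm (\<nu> (y k)) \<le> C * norm x * (1 / 2) ^ k"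
        using \<mu>(2)[of "y k"] \<nu>(2)[of "y k"] by auto
    qed
    have s: "summable (\<lambda>k. \<mu> (y k))" "summable (\<lambda>k. \<nu> (y k))"
      using b geo by (auto intro!: summable_comparison_test'[OF sums_summable[OF geo]])
    have part: "(\<Sum>k<n. \<mu> (y k)) + (\<Sum>k<n. \<nu> (y k)) = x - y n" for n
      by (induction n) (auto simp: y0 ySuc algebra_simps)
    have "(\<lambda>k. (1 / 2) ^ k * norm x) \<longlonglongrightarrow> 0"
      by (rule tendsto_mult_left_zero, rule LIMSEQ_power_zero) simp
    then have "y \<longlonglongrightarrow> 0" by (rule Lim_null_comparison[rotated]) (simp add: ybound)
    then have "(\<lambda>n. x - y n) \<longlonglongrightarrow> x - 0" by (intro tendsto_intros)
    moreover have "(\<lambda>n. (\<Sum>k<n. \<mu> (y k)) + (\<Sum>k<n. \<nu> (y k))) \<longlonglongrightarrow> (\<Sum>k. \<mu> (y k)) + (\<Sum>k. \<nu> (y k))"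
      by (intro tendsto_add summable_LIMSEQ s)
    ultimately have x: "x = (\<Sum>k. \<mu> (y k)) + (\<Sum>k. \<nu> (y k))"
      unfolding part using LIMSEQ_unique by fastforce
    have m: "(\<Sum>k. \<mu> (y k)) \<in> M"
      by (rule closed_sequentially[OF M(2) _ summable_LIMSEQ[OF s(1)]])
         (auto intro: subspace_sum[OF M(1)] \<mu>)
    have n: "(\<Sum>k. \<nu> (y k)) \<in> N"
      by (rule closed_sequentially[OF N(2) _ summable_LIMSEQ[OF s(2)]])
         (auto intro: subspace_sum[OF N(1)] \<nu>)
    have "norm (\<Sum>k. \<mu> (y k)) \<le> 2 * C * norm x"
      using norm_suminf_le[OF b(1) sums_summable[OF geo]] sums_unique[OF geo] by (simp add: mult_ac)
    then show ?thesis using x m n by (intro bexI[OF _ m]) (auto simp: algebra_simps)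
  qed
  then obtain P where P: "\<And>x. P x \<in> M" "\<And>x. x - P x \<in> N" "\<And>x. norm (P x) \<le> 2 * C * norm x"
    by metis
  have uniq: "P x = m" if "m \<in> M" "x - m \<in> N" for x m
  proof -
    have "P x - m \<in> M" using P(1) that M by (simp add: subspace_diff)
    moreover have "P x - m = (x - m) - (x - P x)" by simp
    then have "P x - m \<in> N" using P(2) that N by (metis subspace_diff)
    ultimately have "P x - m \<in> M \<inter> N" by blast
    then show ?thesis using int by simp
  qed
  have "bounded_linear P"
  proof (rule bounded_linear_intro[where K = "2 * C"])
    fix x y
    have "(x + y) - (P x + P y) = (x - P x) + (y - P y)" by simp
    then show "P (x + y) = P x + P y"
      using P M N by (intro uniq) (metis subspace_add)+
  next
    fix r x
    have "r *\<^sub>R x - r *\<^sub>R P x = r *\<^sub>R (x - P x)" by (simp add: scaleR_diff_right)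
    then show "P (r *\<^sub>R x) = r *\<^sub>R P x"
      using P M N by (intro uniq) (metis subspace_scale)+
  next
    show "norm (P x) \<le> norm x * (2 * C)" for x using P(3)[of x] by (simp add: mult.commute)
  qed
  then show thesis using that P by blast
qed

section \<open>Green functions of dichotomies and conjugacy\<close>

text \<open>
  The equation \<open>T x + \<phi> x = y\<close> is the fixed point equation of the contraction
  \<open>x \<mapsto> T\<^bsup>-1\<^esup> (y - \<phi> x)\<close>.
\<close>

lemma bij_perturbation:
  fixes T :: "'a::banach \<Rightarrow> 'a"
  assumes T: "bij T" and inv: "bounded_linear (inv T)"
    and K: "\<And>y. norm (inv T y) \<le> K * norm y" "K > 0"
    and \<phi>: "\<And>x y. norm (\<phi> x - \<phi> y) \<le> \<epsilon> * norm (x - y)" and \<epsilon>: "K * \<epsilon> \<le> 1 / 2"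
  shows "bij (\<lambda>x. T x + \<phi> x)" and "continuous_on UNIV (inv (\<lambda>x. T x + \<phi> x))"
proof -
  interpret inv: bounded_linear "inv T" by (rule inv)
  let ?R = "\<lambda>x. T x + \<phi> x"
  have half: "norm (inv T (\<phi> x) - inv T (\<phi> y)) \<le> norm (x - y) / 2" for x y
  proof -
    have "norm (inv T (\<phi> x) - inv T (\<phi> y)) \<le> K * norm (\<phi> x - \<phi> y)"
      using K(1)[of "\<phi> x - \<phi> y"] by (simp add: inv.diff)
    also have "\<dots> \<le> K * (\<epsilon> * norm (x - y))"
      using \<phi> K(2) by (intro mult_left_mono) auto
    also have "\<dots> = (K * \<epsilon>) * norm (x - y)" by simp
    also have "\<dots> \<le> 1 / 2 * norm (x - y)" using \<epsilon> by (intro mult_right_mono) auto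
    finally show ?thesis by simp
  qed
  have expand: "norm (x - y) \<le> 2 * K * norm (?R x - ?R y)" for x y
  proof -
    have "x - y = inv T (?R x - ?R y) - (inv T (\<phi> x) - inv T (\<phi> y))"
      using T by (simp add: inv.add inv.diff bij_is_inj)
    then have "norm (x - y) \<le> norm (inv T (?R x - ?R y)) + norm (inv T (\<phi> x) - inv T (\<phi> y))"
      by (metis norm_triangle_ineq4)
    also have "\<dots> \<le> K * norm (?R x - ?R y) + norm (x - y) / 2"
      by (intro add_mono K half)
    finally show ?thesis by simp
  qed
  have "inj ?R"
  proof (rule injI)
    fix x y assume "?R x = ?R y"
    then show "x = y" using expand[of x y] by simp
  qed
  moreover have "surj ?R"
    unfolding surj_def
  proof
    fix y
    have "\<exists>!x. inv T (y - \<phi> x) = x"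
    proof (rule banach_fix_type[of "1/2"])
      show "\<forall>x z. dist (inv T (y - \<phi> x)) (inv T (y - \<phi> z)) \<le> 1 / 2 * dist x z"
      proof (intro allI)
        fix x z
        have "inv T (y - \<phi> x) - inv T (y - \<phi> z) = inv T (\<phi> z) - inv T (\<phi> x)"
          by (simp add: inv.diff)
        then show "dist (inv T (y - \<phi> x)) (inv T (y - \<phi> z)) \<le> 1 / 2 * dist x z"
          using half[of z x] by (simp add: dist_norm norm_minus_commute)
      qed
    qed auto
    then obtain x where x: "inv T (y - \<phi> x) = x" by blast
    have "T x = y - \<phi> x"
      using surj_f_inv_f[OF bij_is_surj[OF T], of "y - \<phi> x"] unfolding x .
    then have "y = ?R x" by simp
    then show "\<exists>x. y = ?R x" ..
  qed
  ultimately show bij: "bij ?R" by (simp add: bij_def)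
  have "(2 * K)-lipschitz_on UNIV (inv ?R)"
  proof (rule lipschitz_onI)
    fix y z
    show "dist (inv ?R y) (inv ?R z) \<le> 2 * K * dist y z"
      using expand[of "inv ?R y" "inv ?R z"]
      unfolding dist_norm surj_f_inv_f[OF bij_is_surj[OF bij]] .
  qed (use K in simp)
  then show "continuous_on UNIV (inv ?R)" by (rule lipschitz_on_continuous_on)
qed

lemma continuous_funpow:
  fixes f :: "'b::topological_space \<Rightarrow> 'b"
  shows "continuous_on UNIV f \<Longrightarrow> continuous_on UNIV (f ^^ k)"
  by (induction k) (auto intro: continuous_on_compose2)

text \<open>
  The operators \<open>A k = T\<^sup>k P\<close> and \<open>B k = T\<^bsup>-(k+1)\<^esup> Q\<close> through the recursions that they satisfy. Since
  \<open>T (B 0 y)\<close> is \<open>Q y\<close>, the last axiom says \<open>P + Q = I\<close>.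
\<close>

locale summable_dichotomy =
  fixes T :: "'a::banach \<Rightarrow> 'a" and A B :: "nat \<Rightarrow> 'a \<Rightarrow> 'a" and \<alpha> :: "nat \<Rightarrow> real"
  assumes T: "bounded_linear T"
    and A: "bounded_linear (A k)" and B: "bounded_linear (B k)"
    and A_le: "norm (A k y) \<le> \<alpha> k * norm y" and B_le: "norm (B k y) \<le> \<alpha> k * norm y"
    and \<alpha>: "summable \<alpha>" "0 \<le> \<alpha> k"
    and A_Suc: "A (Suc k) y = T (A k y)" and B_Suc: "T (B (Suc k) y) = B k y"
    and split: "A 0 y + T (B 0 y) = y"
begin

text \<open>
  The Green function of the difference equation \<open>w (R x) = T (w x) + v x\<close> along the orbits of \<open>R\<close>:
  the \<open>M\<close>-components of the forcing \<open>v\<close> are propagated from the past, the \<open>N\<close>-components from the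
  future.
\<close>

definition green :: "('a \<Rightarrow> 'a) \<Rightarrow> ('a \<Rightarrow> 'a) \<Rightarrow> 'a \<Rightarrow> 'a" where
  "green R v x = (\<Sum>k. A k (v ((inv R ^^ Suc k) x))) - (\<Sum>k. B k (v ((R ^^ k) x)))"

text \<open>
  A bound for the norm of \<open>green R\<close> on bounded maps. The summand \<open>1\<close> makes it positive, also when \<open>\<alpha>\<close>
  vanishes.
\<close>

definition gain :: real where "gain = 2 * suminf \<alpha> + 1"

lemma gain_pos: "gain > 0"
  using suminf_nonneg[OF \<alpha>] by (simp add: gain_def)

lemma series_bound:
  assumes C: "\<And>k y. norm (C k y) \<le> \<alpha> k * norm (y :: 'a)" and b: "\<And>k. norm (y k) \<le> b"
  shows "norm (C k (y k)) \<le> b * \<alpha> k" and "summable (\<lambda>k. C k (y k) :: 'a)"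
    and "norm (\<Sum>k. C k (y k)) \<le> b * suminf \<alpha>"
proof -
  show *: "norm (C k (y k)) \<le> b * \<alpha> k" for k
    using C[of k "y k"] mult_left_mono[OF b[of k] \<alpha>(2)[of k]] by (simp add: mult.commute)
  show "summable (\<lambda>k. C k (y k))"
    using * by (rule summable_comparison_test'[OF summable_mult[OF \<alpha>(1)]])
  show "norm (\<Sum>k. C k (y k)) \<le> b * suminf \<alpha>"
    using norm_suminf_le[OF * summable_mult[OF \<alpha>(1)]] suminf_mult[OF \<alpha>(1)] by simp
qed

lemma norm_green_le:
  assumes "\<And>x. norm (v x) \<le> b"
  shows "norm (green R v x) \<le> gain * b"
proof -
  have "b \<ge> 0" using order_trans[OF norm_ge_zero assms] .
  have "norm (green R v x) \<le> b * suminf \<alpha> + b * suminf \<alpha>"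
    unfolding green_def using assms
    by (intro norm_triangle_le_diff add_mono series_bound(3) A_le B_le)
  also have "\<dots> \<le> gain * b" using \<open>b \<ge> 0\<close> by (simp add: gain_def algebra_simps)
  finally show ?thesis .
qed

lemma green_diff:
  assumes "\<And>x. norm (v x) \<le> b" "\<And>x. norm (w x) \<le> b"
  shows "green R v x - green R w x = green R (\<lambda>x. v x - w x) x"
proof -
  have series: "(\<Sum>k. C k (v (y k))) - (\<Sum>k. C k (w (y k))) = (\<Sum>k. C k (v (y k) - w (y k)))"
    if C: "\<And>k. bounded_linear (C k)" "\<And>k y. norm (C k y) \<le> \<alpha> k * norm (y :: 'a)"
    for C :: "nat \<Rightarrow> 'a \<Rightarrow> 'a" and y :: "nat \<Rightarrow> 'a"
  proof -
    have "summable (\<lambda>k. C k (v (y k)))" "summable (\<lambda>k. C k (w (y k)))"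
      by (rule series_bound(2)[OF C(2)], rule assms)+
    then show ?thesis
      by (subst suminf_diff) (simp_all add: linear_diff[OF bounded_linear.linear[OF C(1)]])
  qed
  show ?thesis
    unfolding green_def series[OF A A_le, symmetric] series[OF B B_le, symmetric] by simp
qed

lemma norm_green_diff_le:
  assumes "\<And>x. norm (v x) \<le> b" "\<And>x. norm (w x) \<le> b" "\<And>x. norm (v x - w x) \<le> d"
  shows "norm (green R v x - green R w x) \<le> gain * d"
  unfolding green_diff[OF assms(1,2)] by (rule norm_green_le) (rule assms(3))

text \<open>
  Moving from \<open>x\<close> to \<open>R x\<close> shifts both series by one index. The past series gains the term
  \<open>A 0 (v x)\<close> and the future series loses \<open>T (B 0 (v x))\<close>; together they amount to \<open>v x\<close>.
\<close>

lemma green_step: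
  assumes R: "bij R" and v: "\<And>x. norm (v x) \<le> b"
  shows "green R v (R x) = T (green R v x) + v x"
proof -
  let ?a = "\<lambda>k. A k (v ((inv R ^^ Suc k) x))" and ?b = "\<lambda>k. B k (v ((R ^^ k) x))"
  have sa: "summable ?a" and sb: "summable ?b"
    by (rule series_bound(2)[OF A_le], rule v, rule series_bound(2)[OF B_le], rule v)
  have shift: "A (Suc k) (v ((inv R ^^ Suc (Suc k)) (R x))) = T (?a k)" for k
    using R by (simp add: A_Suc funpow_swap1 bij_is_inj)
  have "(\<lambda>k. T (?a k)) sums T (suminf ?a)"
    by (rule bounded_linear.sums[OF T summable_sums[OF sa]])
  then have "(\<lambda>k. A (Suc k) (v ((inv R ^^ Suc (Suc k)) (R x)))) sums T (suminf ?a)"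
    unfolding shift .
  from sums_Suc[OF this] have 1: "(\<lambda>k. A k (v ((inv R ^^ Suc k) (R x)))) sums (T (suminf ?a) + A 0 (v x))"
    using R by (simp add: bij_is_inj)
  have "(\<lambda>k. T (?b k)) sums T (suminf ?b)"
    by (rule bounded_linear.sums[OF T summable_sums[OF sb]])
  then have "(\<lambda>k. T (?b (Suc k))) sums (T (suminf ?b) - T (?b 0))"
    by (subst sums_Suc_iff) simp
  then have 2: "(\<lambda>k. B k (v ((R ^^ k) (R x)))) sums (T (suminf ?b) - T (B 0 (v x)))"
    by (simp add: B_Suc funpow_swap1)
  have "green R v (R x) = (T (suminf ?a) + A 0 (v x)) - (T (suminf ?b) - T (B 0 (v x)))"
    unfolding green_def sums_unique[OF 1] sums_unique[OF 2] ..
  also have "\<dots> = T (suminf ?a - suminf ?b) + (A 0 (v x) + T (B 0 (v x)))"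
    by (simp add: linear_diff[OF bounded_linear.linear[OF T]])
  finally show ?thesis by (simp add: split green_def)
qed

text \<open>
  The value at \<open>x\<close> depends only on the values of \<open>v\<close> along the two-sided orbit of \<open>x\<close>, and \<open>h\<close> maps
  the \<open>R1\<close>-orbit of \<open>x\<close> onto the \<open>R2\<close>-orbit of \<open>h x\<close>. This is what makes the two semiconjugacies
  inverse to each other although the equations they solve may have many bounded solutions.
\<close>

lemma green_semiconjugacy:
  assumes R1: "bij R1" and R2: "bij R2" and h: "\<And>x. h (R1 x) = R2 (h x)"
  shows "green R1 (\<lambda>x. v (h x)) x = green R2 v (h x)"
proof -
  have fut: "h ((R1 ^^ k) x) = (R2 ^^ k) (h x)" for k
    by (induction k) (auto simp: h)
  have "h (inv R1 x) = inv R2 (h x)" for x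
    using h[of "inv R1 x"] R1 R2 by (metis bij_inv_eq_iff)
  then have past: "h ((inv R1 ^^ k) x) = (inv R2 ^^ k) (h x)" for k
    by (induction k) auto
  show ?thesis unfolding green_def fut past ..
qed

lemma continuous_green:
  assumes R: "continuous_on UNIV R" "continuous_on UNIV (inv R)"
    and v: "continuous_on UNIV v" "\<And>x. norm (v x) \<le> b"
  shows "continuous_on UNIV (green R v)"
proof -
  have series: "continuous_on UNIV (\<lambda>x. \<Sum>k. C k (v ((p k) x)))"
    if C: "\<And>k. bounded_linear (C k)" "\<And>k y. norm (C k y) \<le> \<alpha> k * norm (y :: 'a)"
      and p: "\<And>k. continuous_on UNIV (p k)"
    for C :: "nat \<Rightarrow> 'a \<Rightarrow> 'a" and p :: "nat \<Rightarrow> 'a \<Rightarrow> 'a"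
  proof (rule uniform_limit_theorem)
    show "uniform_limit UNIV (\<lambda>n x. \<Sum>k<n. C k (v (p k x))) (\<lambda>x. \<Sum>k. C k (v (p k x))) sequentially"
    proof (rule Weierstrass_m_test)
      show "norm (C k (v (p k x))) \<le> b * \<alpha> k" for k x
        using series_bound(1)[OF C(2), of "\<lambda>_. v (p k x)" b] v(2) by blast
      show "summable (\<lambda>k. b * \<alpha> k)" using \<alpha>(1) by (rule summable_mult)
    qed
    have "continuous_on UNIV (\<lambda>x. v (p k x))" for k
      by (rule continuous_on_compose2[OF v(1) p]) auto
    then show "\<forall>\<^sub>F n in sequentially. continuous_on UNIV (\<lambda>x. \<Sum>k<n. C k (v (p k x)))"
      by (intro always_eventually allI continuous_on_sum bounded_linear.continuous_on[OF C(1)])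
  qed simp
  show ?thesis
    unfolding green_def
    by (intro continuous_on_diff series A B A_le B_le continuous_funpow R)
qed

text \<open>
  The bound on \<open>gain * \<epsilon>\<close> is used twice: it makes the equation for \<open>h\<close> a contraction, and it shows
  that the semiconjugacy \<open>g\<close> in the opposite direction is a right inverse of \<open>h\<close>.
\<close>

theorem conjugacy:
  assumes bij: "bij T" and inv: "bounded_linear (inv T)"
    and K: "\<And>y. norm (inv T y) \<le> K * norm y" "K > 0"
    and \<phi>: "\<And>x. norm (\<phi> x) \<le> \<epsilon>" "\<And>x y. norm (\<phi> x - \<phi> y) \<le> \<epsilon> * norm (x - y)"
    and \<epsilon>: "K * \<epsilon> \<le> 1 / 2" "gain * \<epsilon> \<le> 1 / 2"
  obtains h g where "homeomorphism UNIV UNIV h g"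
    "\<And>x. h (T x) = T (h x) + \<phi> (h x)" "\<And>x. norm (h x - x) \<le> gain * \<epsilon>"
proof -
  define R where "R = (\<lambda>x. T x + \<phi> x)"
  have \<epsilon>0: "\<epsilon> \<ge> 0" using order_trans[OF norm_ge_zero \<phi>(1)] .
  have R: "bij R" "continuous_on UNIV (inv R)"
    unfolding R_def using bij_perturbation[OF bij inv K \<phi>(2) \<epsilon>(1)] by auto
  have contT: "continuous_on UNIV T" "continuous_on UNIV (inv T)"
    using T inv by (auto intro: bounded_linear.continuous_on)
  have cont\<phi>: "continuous_on UNIV \<phi>"
    by (rule lipschitz_on_continuous_on[of \<epsilon>], rule lipschitz_onI)
       (auto simp: dist_norm \<phi> \<epsilon>0)
  have contR: "continuous_on UNIV R"
    unfolding R_def by (intro continuous_intros contT cont\<phi>)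
  have half: "gain * (\<epsilon> * d) \<le> d / 2" if "d \<ge> 0" for d
    using mult_right_mono[OF \<epsilon>(2) that] by (simp add: mult_ac)

  define F where "F u = green T (\<lambda>x. \<phi> (x + apply_bcontfun u x))" for u :: "'a \<Rightarrow>\<^sub>C 'a"
  have F: "F u \<in> bcontfun" for u
  proof (rule bcontfun_normI)
    have "continuous_on UNIV (\<lambda>x. \<phi> (x + apply_bcontfun u x))"
      by (rule continuous_on_compose2[OF cont\<phi>]) (auto intro!: continuous_intros)
    then show "continuous_on UNIV (F u)"
      unfolding F_def using contT \<phi>(1) by (intro continuous_green)
    show "norm (F u x) \<le> gain * \<epsilon>" for x
      unfolding F_def by (rule norm_green_le) (rule \<phi>(1))
  qed
  have "\<exists>!u. Bcontfun (F u) = u"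
  proof (rule banach_fix_type[of "1/2"])
    show "\<forall>u w. dist (Bcontfun (F u)) (Bcontfun (F w)) \<le> 1 / 2 * dist u w"
    proof (intro allI dist_bound)
      fix u w x
      have "norm (F u x - F w x) \<le> gain * (\<epsilon> * dist u w)"
        unfolding F_def
      proof (rule norm_green_diff_le)
        fix x
        have "norm (\<phi> (x + apply_bcontfun u x) - \<phi> (x + apply_bcontfun w x))
            \<le> \<epsilon> * dist (apply_bcontfun u x) (apply_bcontfun w x)"
          using \<phi>(2)[of "x + apply_bcontfun u x" "x + apply_bcontfun w x"] by (simp add: dist_norm)
        also have "\<dots> \<le> \<epsilon> * dist u w" using \<epsilon>0 by (intro mult_left_mono dist_bounded)
        finally show "norm (\<phi> (x + apply_bcontfun u x) - \<phi> (x + apply_bcontfun w x)) \<le> \<epsilon> * dist u w" .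
      qed (rule \<phi>(1))+
      also have "\<dots> \<le> dist u w / 2" by (rule half) simp
      finally show "dist (apply_bcontfun (Bcontfun (F u)) x) (apply_bcontfun (Bcontfun (F w)) x) \<le> 1 / 2 * dist u w"
        using F by (simp add: Bcontfun_inverse dist_norm)
    qed
  qed auto
  then obtain u where "Bcontfun (F u) = u" by blast
  then have u: "apply_bcontfun u = F u" using F by (metis Bcontfun_inverse)

  define h where "h x = x + apply_bcontfun u x" for x
  define G where "G = green T (\<lambda>x. \<phi> (h x))"
  have u_G: "apply_bcontfun u = G"
    by (subst u) (simp only: F_def G_def h_def)
  have h_G: "h x = x + G x" for x by (simp add: h_def u_G)
  have G_step: "G (T x) = T (G x) + \<phi> (h x)" for x
    unfolding G_def by (rule green_step[OF bij]) (rule \<phi>(1))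
  have h_conj: "h (T x) = R (h x)" for x
    by (simp add: h_G[of "T x"] G_step R_def) (simp add: h_G linear_add[OF bounded_linear.linear[OF T]])

  define g where "g x = x - green R \<phi> x" for x
  have g_conj: "g (R x) = T (g x)" for x
  proof -
    have "green R \<phi> (R x) = T (green R \<phi> x) + \<phi> x"
      by (rule green_step[OF R(1)]) (rule \<phi>(1))
    then show ?thesis
      by (simp add: g_def linear_diff[OF bounded_linear.linear[OF T]]) (simp add: R_def)
  qed

  \<comment> \<open>Naturality along \<open>h\<close>: the correction \<open>G\<close> in \<open>h\<close> is the one that \<open>g\<close> undoes at \<open>h x\<close>.\<close>
  have gh: "g (h x) = x" for x
  proof -
    have "G x = green R \<phi> (h x)"
      unfolding G_def by (rule green_semiconjugacy[where h = h and v = \<phi>, OF bij R(1) h_conj])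
    then show ?thesis by (simp add: g_def) (simp add: h_G)
  qed

  \<comment> \<open>Naturality along \<open>g\<close> expresses \<open>h \<circ> g - I\<close> by itself, through the Lipschitz map \<open>\<phi>\<close>.\<close>
  have hg_diff: "h (g x) - x = green R (\<lambda>x. \<phi> (h (g x))) x - green R \<phi> x" for x
  proof -
    have "G (g x) = green R (\<lambda>x. \<phi> (h (g x))) x"
      unfolding G_def by (rule green_semiconjugacy[where h = g and v = "\<lambda>x. \<phi> (h x)", OF R(1) bij g_conj, symmetric])
    then show ?thesis by (simp add: h_G[of "g x"]) (simp add: g_def)
  qed
  have bdd: "norm (h (g x) - x) \<le> gain * (2 * \<epsilon>)" for x
    unfolding hg_diff
  proof (rule norm_green_diff_le)
    show "norm (\<phi> (h (g x)) - \<phi> x) \<le> 2 * \<epsilon>" for x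
      using norm_triangle_ineq4[of "\<phi> (h (g x))" "\<phi> x"] \<phi>(1)[of x] \<phi>(1)[of "h (g x)"] by linarith
  qed (rule \<phi>(1))+
  \<comment> \<open>The supremum \<open>d\<close> is finite by the preceding bound, so \<open>d \<le> d / 2\<close> forces \<open>d = 0\<close>.\<close>
  have hg: "h (g x) = x" for x
  proof -
    define d where "d = (SUP x. norm (h (g x) - x))"
    have le: "norm (h (g x) - x) \<le> d" for x
      unfolding d_def using bdd by (intro cSUP_upper) (auto simp: bdd_above_def)
    have d0: "d \<ge> 0" using order_trans[OF norm_ge_zero le] .
    have "norm (h (g x) - x) \<le> d / 2" for x
    proof -
      have "norm (h (g x) - x) \<le> gain * (\<epsilon> * d)"
        unfolding hg_diff[of x]
      proof (rule norm_green_diff_le)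
        show "norm (\<phi> (h (g x)) - \<phi> x) \<le> \<epsilon> * d" for x
          using order_trans[OF \<phi>(2) mult_left_mono[OF le \<epsilon>0]] .
      qed (rule \<phi>(1))+
      then show ?thesis using half[OF d0] by linarith
    qed
    then have "d \<le> d / 2" unfolding d_def by (intro cSUP_least) (auto simp: d_def)
    then show ?thesis using le[of x] d0 by simp
  qed

  show thesis
  proof (rule that)
    have "continuous_on UNIV h" unfolding h_def by (intro continuous_intros continuous_on_apply_bcontfun)
    moreover have "continuous_on UNIV g"
      unfolding g_def using continuous_green[of R \<phi> \<epsilon>, OF contR R(2) cont\<phi> \<phi>(1)]
      by (intro continuous_on_diff continuous_on_id)
    ultimately show "homeomorphism UNIV UNIV h g"
      using gh hg by (auto intro!: homeomorphismI)
    show "h (T x) = T (h x) + \<phi> (h x)" for x using h_conj by (simp add: R_def)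
    show "norm (h x - x) \<le> gain * \<epsilon>" for x
    proof -
      have "norm (G x) \<le> gain * \<epsilon>"
        unfolding G_def by (rule norm_green_le) (rule \<phi>(1))
      then show ?thesis by (simp add: h_G)
    qed
  qed
qed

end

section \<open>Structural stability\<close>

text \<open>
  With \<open>r = (1/2)\<^bsup>1/n\<^esup>\<close> the decay by \<open>1/2\<close> per block of length \<open>n\<close> becomes decay like \<open>r\<^sup>k\<close>. The factor
  \<open>2\<close> pays for an incomplete last block, on which \<open>c\<^sup>n\<close> bounds the growth.
\<close>

lemma summable_decay_of_power_contraction:
  fixes S :: "'a::real_normed_vector \<Rightarrow> 'a"
  assumes V: "\<And>x. x \<in> V \<Longrightarrow> S x \<in> V" and S: "\<And>x. norm (S x) \<le> K * norm x"
    and n: "n \<ge> 1" "\<And>x. x \<in> V \<Longrightarrow> norm ((S ^^ n) x) \<le> 1 / 2 * norm x"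
  obtains \<alpha> where "summable \<alpha>" "\<And>k. 0 \<le> \<alpha> k"
    "\<And>k x. x \<in> V \<Longrightarrow> norm ((S ^^ k) x) \<le> \<alpha> k * norm x"
proof -
  define c where "c = max 1 K"
  define r where "r = root n (1 / 2)"
  have r: "0 < r" "r < 1" "r ^ n = 1 / 2" using n by (auto simp: r_def)
  have mem: "(S ^^ k) x \<in> V" if "x \<in> V" for k x
    using that by (induction k) (auto simp: V)
  have crude: "norm ((S ^^ k) x) \<le> c ^ k * norm x" for k x
  proof (induction k)
    case (Suc k)
    have "norm ((S ^^ Suc k) x) \<le> K * norm ((S ^^ k) x)" using S by simp
    also have "\<dots> \<le> c * norm ((S ^^ k) x)" by (intro mult_right_mono) (auto simp: c_def)
    also have "\<dots> \<le> c * (c ^ k * norm x)" using Suc by (intro mult_left_mono) (auto simp: c_def)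
    finally show ?case by simp
  qed simp
  have blocks: "norm ((S ^^ (n * j)) x) \<le> (1 / 2) ^ j * norm x" if "x \<in> V" for j x
  proof (induction j)
    case (Suc j)
    have "norm ((S ^^ (n * Suc j)) x) = norm ((S ^^ n) ((S ^^ (n * j)) x))"
      by (simp add: funpow_add)
    also have "\<dots> \<le> 1 / 2 * norm ((S ^^ (n * j)) x)" by (rule n(2)[OF mem[OF that]])
    finally show ?case using Suc by simp
  qed simp
  have "norm ((S ^^ k) x) \<le> (2 * c ^ n * r ^ k) * norm x" if x: "x \<in> V" for k x
  proof -
    define j i where "j = k div n" and "i = k mod n"
    have k: "k = i + n * j" and i: "i \<le> n" using n by (auto simp: j_def i_def)
    have "norm ((S ^^ k) x) \<le> c ^ i * norm ((S ^^ (n * j)) x)"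
      unfolding k funpow_add using crude by simp
    also have "\<dots> \<le> c ^ n * ((1 / 2) ^ j * norm x)"
      using i by (intro mult_mono blocks x power_increasing) (auto simp: c_def)
    also have "(1 / 2) ^ j * norm x \<le> (2 * r ^ k) * norm x"
    proof (rule mult_right_mono)
      have "r ^ n \<le> r ^ i" using r i by (intro power_decreasing) auto
      then have "1 \<le> 2 * r ^ i" using r by simp
      then have "(1 / 2) ^ j * 1 \<le> (1 / 2) ^ j * (2 * r ^ i)" by (intro mult_left_mono) auto
      also have "\<dots> = 2 * r ^ k" by (simp add: k power_add power_mult r)
      finally show "(1 / 2) ^ j \<le> 2 * r ^ k" by simp
    qed simp
    finally show ?thesis by (simp add: c_def mult_left_mono mult_ac)
  qed
  moreover have "summable (\<lambda>k. 2 * c ^ n * r ^ k)"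
    using r by (intro summable_mult summable_geometric) auto
  ultimately show thesis using that[of "\<lambda>k. 2 * c ^ n * r ^ k"] r by (simp add: c_def)
qed

lemma norm_le_of_sup_norm_le:
  assumes "sup_norm f \<le> ennreal b" "b \<ge> 0"
  shows "norm (f x) \<le> b"
proof -
  have "ennreal (norm (f x)) \<le> sup_norm f" unfolding sup_norm_def by (rule SUP_upper) simp
  then show ?thesis using assms by (metis ennreal_le_iff order_trans)
qed

lemma norm_diff_le_of_Lip_le:
  assumes "Lip f \<le> ennreal b" "b \<ge> 0"
  shows "norm (f x - f y) \<le> b * norm (x - y)"
proof (cases "x = y")
  case False
  have "ennreal (norm (f x - f y) / norm (x - y)) \<le> Lip f"
    unfolding Lip_def by (rule SUP_upper2[of "(x, y)"]) (use False in auto)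
  then have "norm (f x - f y) / norm (x - y) \<le> b"
    using assms by (metis ennreal_le_iff order_trans)
  then show ?thesis using False by (simp add: field_simps)
qed simp

text \<open>
  From here on only real linear structure matters, so the real and the complex case share this
  statement.
\<close>

theorem strongly_structurally_stable_of_power_contractions:
  fixes T :: "'a::banach \<Rightarrow> 'a"
  assumes iso: "bounded_linear T" "bij T" "bounded_linear (inv T)"
    and M: "subspace M" "closed M" and N: "subspace N" "closed N"
    and sum: "{m + n | m n. m \<in> M \<and> n \<in> N} = UNIV" and int: "M \<inter> N = {0}"
    and inv: "T ` M \<subseteq> M" "inv T ` N \<subseteq> N"
    and p: "p \<ge> 1" "\<And>x. x \<in> M \<Longrightarrow> norm ((T ^^ p) x) \<le> 1 / 2 * norm x"
    and q: "q \<ge> 1" "\<And>x. x \<in> N \<Longrightarrow> norm ((inv T ^^ q) x) \<le> 1 / 2 * norm x"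
  shows "strongly_structurally_stable T"
proof -
  obtain P where P: "bounded_linear P" "\<And>x. P x \<in> M" "\<And>x. x - P x \<in> N"
    using bounded_projection_exists[OF M N sum int] by blast
  define Q where "Q x = x - P x" for x
  have Q: "bounded_linear Q" unfolding Q_def by (intro bounded_linear_sub bounded_linear_ident P)
  obtain KP where KP: "KP > 0" "\<And>x. norm (P x) \<le> KP * norm x"
    using bounded_linear.pos_bounded[OF P(1)] by (auto simp: mult.commute)
  obtain KQ where KQ: "KQ > 0" "\<And>x. norm (Q x) \<le> KQ * norm x"
    using bounded_linear.pos_bounded[OF Q] by (auto simp: mult.commute)
  obtain KT where KT: "\<And>x. norm (T x) \<le> KT * norm x"
    using bounded_linear.pos_bounded[OF iso(1)] by (auto simp: mult.commute)
  obtain K where K: "K > 0" "\<And>x. norm (inv T x) \<le> K * norm x"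
    using bounded_linear.pos_bounded[OF iso(3)] by (auto simp: mult.commute)
  have invM: "\<And>x. x \<in> M \<Longrightarrow> T x \<in> M" and invN: "\<And>x. x \<in> N \<Longrightarrow> inv T x \<in> N"
    using inv by auto
  obtain \<beta> where \<beta>: "summable \<beta>" "\<And>k. 0 \<le> \<beta> k"
      "\<And>k x. x \<in> M \<Longrightarrow> norm ((T ^^ k) x) \<le> \<beta> k * norm x"
    using summable_decay_of_power_contraction[of M T KT p, OF invM KT p] by blast
  obtain \<gamma> where \<gamma>: "summable \<gamma>" "\<And>k. 0 \<le> \<gamma> k"
      "\<And>k x. x \<in> N \<Longrightarrow> norm ((inv T ^^ k) x) \<le> \<gamma> k * norm x"
    using summable_decay_of_power_contraction[of N "inv T" K q, OF invN K(2) q] by blast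
  define \<alpha> where "\<alpha> k = \<beta> k * KP + \<gamma> (Suc k) * KQ" for k

  have funpow_linear: "bounded_linear (f ^^ k)" if "bounded_linear f" for f :: "'a \<Rightarrow> 'a" and k
    using that by (induction k) (auto simp: o_def id_def intro: bounded_linear_compose bounded_linear_ident)

  interpret summable_dichotomy T "\<lambda>k x. (T ^^ k) (P x)" "\<lambda>k x. (inv T ^^ Suc k) (Q x)" \<alpha>
  proof (rule summable_dichotomy.intro)
    show "bounded_linear T" by (rule iso)
    show "bounded_linear (\<lambda>x. (T ^^ k) (P x))" for k
      by (rule bounded_linear_compose[OF funpow_linear[OF iso(1)] P(1)])
    show "bounded_linear (\<lambda>x. (inv T ^^ Suc k) (Q x))" for k
      by (rule bounded_linear_compose[OF funpow_linear[OF iso(3)] Q])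
    show "norm ((T ^^ k) (P y)) \<le> \<alpha> k * norm y" for k y
    proof -
      have "norm ((T ^^ k) (P y)) \<le> \<beta> k * norm (P y)" by (rule \<beta>(3)[OF P(2)])
      also have "\<dots> \<le> \<beta> k * (KP * norm y)" by (intro mult_left_mono KP \<beta>)
      also have "\<dots> \<le> \<alpha> k * norm y"
        using \<gamma>(2)[of "Suc k"] KQ(1) by (simp add: \<alpha>_def distrib_right)
      finally show ?thesis .
    qed
    show "norm ((inv T ^^ Suc k) (Q y)) \<le> \<alpha> k * norm y" for k y
    proof -
      have "norm ((inv T ^^ Suc k) (Q y)) \<le> \<gamma> (Suc k) * norm (Q y)"
        by (rule \<gamma>(3)) (simp add: Q_def P)
      also have "\<dots> \<le> \<gamma> (Suc k) * (KQ * norm y)" by (intro mult_left_mono KQ \<gamma>)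
      also have "\<dots> \<le> \<alpha> k * norm y"
        using \<beta>(2)[of k] KP(1) by (simp add: \<alpha>_def distrib_right)
      finally show ?thesis .
    qed
    show "summable \<alpha>"
      unfolding \<alpha>_def using \<gamma>(1) by (intro summable_add summable_mult2 \<beta>) (simp add: summable_Suc_iff)
    show "0 \<le> \<alpha> k" for k using \<beta>(2) \<gamma>(2) KP(1) KQ(1) by (simp add: \<alpha>_def)
    show "(T ^^ Suc k) (P y) = T ((T ^^ k) (P y))" for k y by simp
    have T_inv: "T (inv T z) = z" for z using iso(2) by (simp add: bij_is_surj surj_f_inv_f)
    show "T ((inv T ^^ Suc (Suc k)) (Q y)) = (inv T ^^ Suc k) (Q y)" for k y by (simp add: T_inv)
    show "(T ^^ 0) (P y) + T ((inv T ^^ Suc 0) (Q y)) = y" for y by (simp add: T_inv Q_def)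
  qed

  show ?thesis
    unfolding strongly_structurally_stable_def
  proof (intro allI impI)
    fix \<delta> :: real assume \<delta>: "\<delta> > 0"
    \<comment> \<open>The three constraints: closeness of \<open>h\<close> to the identity, contraction of the equation for
      \<open>h\<close>, and invertibility of \<open>T + \<phi>\<close>.\<close>
    define \<epsilon> where "\<epsilon> = min (\<delta> / gain) (min (1 / (2 * gain)) (1 / (2 * K)))"
    have \<epsilon>: "\<epsilon> > 0" using \<delta> gain_pos K(1) by (simp add: \<epsilon>_def)
    have "\<epsilon> \<le> \<delta> / gain" "\<epsilon> \<le> 1 / (2 * gain)" "\<epsilon> \<le> 1 / (2 * K)" by (auto simp: \<epsilon>_def)
    then have small: "gain * \<epsilon> \<le> \<delta>" "gain * \<epsilon> \<le> 1 / 2" "K * \<epsilon> \<le> 1 / 2"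
      using gain_pos K(1) by (auto simp: field_simps)
    show "\<exists>\<epsilon>>0. \<forall>\<phi>. bounded (range \<phi>) \<and> uniformly_continuous_on UNIV \<phi> \<and>
        (\<exists>L. L-lipschitz_on UNIV \<phi>) \<and> sup_norm \<phi> \<le> ennreal \<epsilon> \<and> Lip \<phi> \<le> ennreal \<epsilon> \<longrightarrow>
        (\<exists>h. (\<exists>g. homeomorphism UNIV UNIV h g) \<and> h \<circ> T = (\<lambda>x. T x + \<phi> x) \<circ> h \<and>
             sup_norm (\<lambda>x. h x - x) \<le> ennreal \<delta>)"
    proof (intro exI[of _ \<epsilon>] conjI allI impI \<epsilon>; elim conjE)
      fix \<phi> :: "'a \<Rightarrow> 'a"
      assume "sup_norm \<phi> \<le> ennreal \<epsilon>" and "Lip \<phi> \<le> ennreal \<epsilon>"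
      then have \<phi>: "\<And>x. norm (\<phi> x) \<le> \<epsilon>" "\<And>x y. norm (\<phi> x - \<phi> y) \<le> \<epsilon> * norm (x - y)"
        using \<epsilon> by (simp_all add: norm_le_of_sup_norm_le norm_diff_le_of_Lip_le)
      obtain h g where hg: "homeomorphism UNIV UNIV h g"
        "\<And>x. h (T x) = T (h x) + \<phi> (h x)" "\<And>x. norm (h x - x) \<le> gain * \<epsilon>"
        using conjugacy[OF iso(2,3) K(2,1) \<phi> small(3,2)] by blast
      have "sup_norm (\<lambda>x. h x - x) \<le> ennreal \<delta>"
        unfolding sup_norm_def
        by (intro SUP_least ennreal_leI order_trans[OF hg(3) small(1)])
      then show "\<exists>h. (\<exists>g. homeomorphism UNIV UNIV h g) \<and> h \<circ> T = (\<lambda>x. T x + \<phi> x) \<circ> h \<and>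
             sup_norm (\<lambda>x. h x - x) \<le> ennreal \<delta>"
        using hg(1,2) by (intro exI[of _ h]) (auto simp: fun_eq_iff)
    qed
  qed
qed

lemma complex_scaling_scaleC:
  assumes "module.subspace scaleC (V :: 'a::complex_banach set)"
  shows "complex_scaling scaleC V 1"
  by (rule complex_scaling.intro)
     (simp_all add: vector_space_scaleC scaleC_of_real norm_scaleC assms)

lemma real_subspace_of_complex_subspace:
  assumes "module.subspace scaleC (V :: 'a::complex_banach set)"
  shows "subspace V"
proof -
  interpret complex_scaling scaleC V 1 by (rule complex_scaling_scaleC[OF assms])
  show ?thesis
    using V_closed(1,2) V_closed(4)[of _ "complex_of_real _"] by (auto simp: subspace_def scaleC_of_real)
qed

lemma power_contracts_of_complex_spectrum:
  fixes S :: "'a::complex_banach \<Rightarrow> 'a"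
  assumes "bounded_linear S" "\<And>c x. S (scaleC c x) = scaleC c (S x)"
    and "module.subspace scaleC V" "S ` V \<subseteq> V" "complex_spectrum_on V S \<subseteq> ball 0 1"
  obtains n where "n \<ge> 1" "\<And>x. x \<in> V \<Longrightarrow> norm ((S ^^ n) x) \<le> 1 / 2 * norm x"
proof -
  interpret complex_scaling scaleC V 1 by (rule complex_scaling_scaleC[OF assms(3)])
  obtain K where "\<And>x. norm (S x) \<le> K * norm x"
    using bounded_linear.bounded[OF assms(1)] by (auto simp: mult.commute)
  then have "bounded_operator_on scaleC V S"
    using assms(2,4) linear_add[OF bounded_linear.linear[OF assms(1)]]
    unfolding bounded_operator_on_def by blast
  from power_contracts_of_spectrum[OF this assms(5)] show thesis using that by blast
qed

text \<open>
  Multiplication by \<open>i\<close>, which sends \<open>(x, y)\<close> to \<open>(- y, x)\<close>, is isometric for the product norm.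
\<close>

lemma norm_complexification_scale_le:
  "norm (complexification_scale c z) \<le> 2 * cmod c * norm (z :: 'a::real_normed_vector \<times> 'a)"
proof -
  obtain x y where z: "z = (x, y)" by (cases z)
  have "complexification_scale c z = Re c *\<^sub>R z + Im c *\<^sub>R (- y, x)"
    by (simp add: complexification_scale_def z algebra_simps)
  also have "norm \<dots> \<le> \<bar>Re c\<bar> * norm z + \<bar>Im c\<bar> * norm (- y, x)"
    by (rule norm_triangle_ineq[THEN order_trans]) (simp del: scaleR_Pair)
  also have "norm (- y, x) = norm z" by (simp add: z norm_Pair add.commute)
  also have "\<bar>Re c\<bar> * norm z + \<bar>Im c\<bar> * norm z \<le> cmod c * norm z + cmod c * norm z"
    by (intro add_mono mult_right_mono abs_Re_le_cmod abs_Im_le_cmod) auto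
  finally show ?thesis by simp
qed

text \<open>
  The complexified operator acts componentwise, so a contracting power of it can be read off on the
  vectors \<open>(x, 0)\<close>.
\<close>

lemma power_contracts_of_real_spectrum:
  fixes S :: "'a::real_normed_vector \<Rightarrow> 'a"
  assumes S: "bounded_linear S"
    and V: "subspace V" "S ` V \<subseteq> V" and spec: "real_spectrum_on V S \<subseteq> ball 0 1"
  obtains n where "n \<ge> 1" "\<And>x. x \<in> V \<Longrightarrow> norm ((S ^^ n) x) \<le> 1 / 2 * norm x"
proof -
  interpret complex_scaling complexification_scale "V \<times> V" 2
  proof (rule complex_scaling.intro)
    show "vector_space (complexification_scale :: complex \<Rightarrow> 'a \<times> 'a \<Rightarrow> 'a \<times> 'a)"
      by (rule vector_space_complexification_scale)
    then have m: "module (complexification_scale :: complex \<Rightarrow> 'a \<times> 'a \<Rightarrow> 'a \<times> 'a)"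
      by (simp add: module_iff_vector_space)
    show "module.subspace complexification_scale (V \<times> V)"
      unfolding module.subspace_def[OF m]
      using V(1) by (auto simp: complexification_scale_def zero_prod_def subspace_0 subspace_add
          subspace_diff subspace_scale)
    show "complexification_scale (complex_of_real r) x = r *\<^sub>R x" for r and x :: "'a \<times> 'a"
      by (cases x) (simp add: complexification_scale_def)
  qed (rule norm_complexification_scale_le)
  interpret S: bounded_linear S by (rule S)
  obtain K where K: "\<And>x. norm (S x) \<le> K * norm x" "K > 0"
    using S.pos_bounded by (auto simp: mult.commute)
  have "norm (map_prod S S z) \<le> (2 * K) * norm z" for z
  proof -
    obtain x y where z: "z = (x, y)" by (cases z)
    have "norm (S x, S y) \<le> norm (S x) + norm (S y)" by (rule norm_Pair_le)
    also have "\<dots> \<le> K * norm z + K * norm z"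
      using K norm_fst_le[of x y] norm_snd_le[of y x]
      by (intro add_mono order_trans[OF K(1)] mult_left_mono) (auto simp: z)
    finally show ?thesis by (simp add: z)
  qed
  then have "\<exists>K. \<forall>z\<in>V \<times> V. norm (map_prod S S z) \<le> K * norm z" by blast
  then have bounded: "bounded_operator_on complexification_scale (V \<times> V) (map_prod S S)"
    using V(2) unfolding bounded_operator_on_def
    by (intro conjI) (auto simp: complexification_scale_def S.add S.diff S.scaleR)
  from power_contracts_of_spectrum[OF bounded spec[unfolded real_spectrum_on_def]]
  obtain n where n: "n \<ge> 1"
    "\<And>z. z \<in> V \<times> V \<Longrightarrow> norm ((map_prod S S ^^ n) z) \<le> 1 / 2 * norm z"
    by blast
  have pow: "(map_prod S S ^^ k) (x, y) = ((S ^^ k) x, (S ^^ k) y)" for k x y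
    by (induction k) auto
  have zero: "(S ^^ k) 0 = 0" for k by (induction k) (auto simp: S.zero)
  have "norm ((S ^^ n) x) \<le> 1 / 2 * norm x" if "x \<in> V" for x
    using n(2)[of "(x, 0)"] that subspace_0[OF V(1)] by (simp add: pow zero norm_Pair)
  then show thesis by (rule that[OF n(1)])
qed

theorem theorem1:
  "(\<forall>T :: 'a::banach \<Rightarrow> 'a.
      generalized_hyperbolic_real T \<longrightarrow> strongly_structurally_stable T) \<and>
   (\<forall>T :: 'b::complex_banach \<Rightarrow> 'b.
      generalized_hyperbolic_complex T \<longrightarrow> strongly_structurally_stable T)"
proof (intro conjI allI impI)
  fix T :: "'a \<Rightarrow> 'a"
  assume "generalized_hyperbolic_real T"
  then obtain M N where T: "bounded_linear T" "bij T" "bounded_linear (inv T)"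
    and M: "subspace M" "closed M" and N: "subspace N" "closed N"
    and split: "{m + n | m n. m \<in> M \<and> n \<in> N} = UNIV" "M \<inter> N = {0}"
    and invariant: "T ` M \<subseteq> M" "inv T ` N \<subseteq> N"
    and spec: "real_spectrum_on M T \<subseteq> ball 0 1" "real_spectrum_on N (inv T) \<subseteq> ball 0 1"
    unfolding generalized_hyperbolic_real_def by (elim exE conjE) (rule that; assumption)
  obtain p where p: "p \<ge> 1" "\<And>x. x \<in> M \<Longrightarrow> norm ((T ^^ p) x) \<le> 1 / 2 * norm x"
    using power_contracts_of_real_spectrum[OF T(1) M(1) invariant(1) spec(1)] by blast
  obtain q where q: "q \<ge> 1" "\<And>x. x \<in> N \<Longrightarrow> norm ((inv T ^^ q) x) \<le> 1 / 2 * norm x"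
    using power_contracts_of_real_spectrum[OF T(3) N(1) invariant(2) spec(2)] by blast
  show "strongly_structurally_stable T"
    by (rule strongly_structurally_stable_of_power_contractions[OF T M N split invariant p q])
next
  fix T :: "'b \<Rightarrow> 'b"
  assume "generalized_hyperbolic_complex T"
  then obtain M N where lin: "Vector_Spaces.linear scaleC scaleC T"
    and T: "bounded_linear T" "bij T" "bounded_linear (inv T)"
    and M: "module.subspace scaleC M" "closed M" and N: "module.subspace scaleC N" "closed N"
    and split: "{m + n | m n. m \<in> M \<and> n \<in> N} = UNIV" "M \<inter> N = {0}"
    and invariant: "T ` M \<subseteq> M" "inv T ` N \<subseteq> N"
    and spec: "complex_spectrum_on M T \<subseteq> ball 0 1" "complex_spectrum_on N (inv T) \<subseteq> ball 0 1"
    unfolding generalized_hyperbolic_complex_def by (elim exE conjE) (rule that; assumption)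
  have T_scale: "T (scaleC c x) = scaleC c (T x)" for c x
    by (rule module_hom.scale[OF module_hom_iff_linear[THEN iffD2, OF lin]])
  have inv_scale: "inv T (scaleC c x) = scaleC c (inv T x)" for c x
    using T_scale[of c "inv T x"] T(2) by (metis bij_inv_eq_iff)
  obtain p where p: "p \<ge> 1" "\<And>x. x \<in> M \<Longrightarrow> norm ((T ^^ p) x) \<le> 1 / 2 * norm x"
    using power_contracts_of_complex_spectrum[OF T(1) T_scale M(1) invariant(1) spec(1)] by blast
  obtain q where q: "q \<ge> 1" "\<And>x. x \<in> N \<Longrightarrow> norm ((inv T ^^ q) x) \<le> 1 / 2 * norm x"
    using power_contracts_of_complex_spectrum[OF T(3) inv_scale N(1) invariant(2) spec(2)] by blast
  show "strongly_structurally_stable T"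
    by (rule strongly_structurally_stable_of_power_contractions[OF T
          real_subspace_of_complex_subspace[OF M(1)] M(2)
          real_subspace_of_complex_subspace[OF N(1)] N(2) split invariant p q])
qed

end
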